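(* Let $\mathbf{u}=(\mathcal{U},\mathcal{W})$ be a $t$-structure in a triangulated category $\mathcal{D}$ with heart $\mathcal{H}$ and extended heart $\mathcal{C}$, and let $\mathsf{E}_{\mathbf{u}}^{-}:\mathsf{stors}\,\mathcal{C}^{-}\to\mathbb{T}_{\mathbf{u}}^{-}$ be the isomorphism of posets given by restricting the extended tilt $\mathsf{E}_{\mathbf{u}}$ to $\mathsf{stors}\,\mathcal{C}^{-}$. Then the following statements hold. (a) The map $\mu^{-}:\mathsf{stors}\,\Sigma^{-1}\mathcal{H}\to\mathsf{stors}\,\mathcal{C}^{-}$, $(\mathcal{T},\mathcal{F})\mapsto(\mathcal{H}\star\mathcal{T},\mathcal{F})$, is an isomorphism of posets whose inverse is $\lambda^{-}:\mathsf{stors}\,\mathcal{C}^{-}\to\mathsf{stors}\,\Sigma^{-1}\mathcal{H}$, $(\mathcal{X},\mathcal{Y})\mapsto(\mathcal{X}\cap\Sigma^{-1}\mathcal{H},\mathcal{Y})$. Furthermore, $\mathcal{X}=\mathcal{H}\star(\mathcal{X}\cap\Sigma^{-1}\mathcal{H})$ for every $(\mathcal{X},\mathcal{Y})\in\mathsf{stors}\,\mathcal{C}^{-}$, $\mathcal{T}=(\mathcal{H}\star\mathcal{T})\cap\Sigma^{-1}\mathcal{H}$ for every $(\mathcal{T},\mathcal{F})\in\mathsf{stors}\,\Sigma^{-1}\mathcal{H}$, and $\mathsf{stors}\,\mathcal{C}^{-}=\{(\mathcal{X},\mathcal{Y})\in\mathsf{stors}\,\mathcal{C}:\mathcal{Y}\subseteq\Sigma^{-1}\mathcal{H}\}$.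 (b) $\mathsf{E}_{\mathbf{u}}^{-}\circ\mu^{-}\circ\Sigma^{-1}=\mathsf{L}_{\mathbf{u}}$, where $\Sigma^{-1}:\mathsf{stors}\,\mathcal{H}\to\mathsf{stors}\,\Sigma^{-1}\mathcal{H}$ is $(\mathcal{T},\mathcal{F})\mapsto(\Sigma^{-1}\mathcal{T},\Sigma^{-1}\mathcal{F})$, and each of the maps $\mathsf{E}_{\mathbf{u}}^{-}$, $\mu^{-}$, $\Sigma^{-1}$, $\mathsf{L}_{\mathbf{u}}$ is an isomorphism of posets.
   Context: Let $\mathcal{D}$ be a triangulated category with shift automorphism $\Sigma$. For classes $\mathcal{A},\mathcal{B}\subseteq\mathcal{D}$, $\mathcal{A}\star\mathcal{B}$ is the class of $C\in\mathcal{D}$ admitting a distinguished triangle $A\to C\to B\to\Sigma A$ with $A\in\mathcal{A}$, $B\in\mathcal{B}$. For a full extension-closed subcategory $\mathcal{X}\subseteq\mathcal{D}$, an $s$-torsion pair in $\mathcal{X}$ is a pair $(\mathcal{T},\mathcal{F})$ of full isomorphism-closed subcategories of $\mathcal{X}$ with $\mathrm{Hom}_{\mathcal{D}}(\mathcal{T},\mathcal{F})=0$, $\mathrm{Hom}_{\mathcal{D}}(\mathcal{T},\Sigma^{-1}\mathcal{F})=0$, and $\mathcal{X}=\mathcal{T}\star\mathcal{F}$. $\mathsf{stors}\,\mathcal{X}$ is the poset of $s$-torsion pairs in $\mathcal{X}$ ordered by inclusion of first components. (For $\mathcal{X}$ the heart of a $t$-structure these are the usual torsion pairs.) A $t$-structure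 in $\mathcal{D}$ is a pair $\mathbf{u}=(\mathcal{U},\mathcal{W})$ of full isomorphism-closed subcategories with $\Sigma\mathcal{U}\subseteq\mathcal{U}$, $\mathrm{Hom}_{\mathcal{D}}(\mathcal{U},\Sigma^{-1}\mathcal{W})=0$ and $\mathcal{D}=\mathcal{U}\star\Sigma^{-1}\mathcal{W}$. Its heart is $\mathcal{H}=\mathcal{U}\cap\mathcal{W}$ and its extended heart is $\mathcal{C}=\mathcal{W}\cap\Sigma^{-1}\mathcal{U}$. $\mathbb{T}_{\mathbf{u}}$ is the class of $t$-structures $(\mathcal{U}',\mathcal{W}')$ with $\Sigma\mathcal{U}\subseteq\mathcal{U}'\subseteq\Sigma^{-1}\mathcal{U}$, ordered by inclusion of first components, and $\mathbb{T}_{\mathbf{u}}^{-}=\{(\mathcal{U}',\mathcal{W}')\in\mathbb{T}_{\mathbf{u}}:\mathcal{U}\subseteq\mathcal{U}'\}$. $\mathsf{stors}\,\mathcal{C}^{-}=\{(\mathcal{X},\mathcal{Y})\in\mathsf{stors}\,\mathcal{C}:\mathcal{H}\subseteq\mathcal{X}\}$. The extended tilt is the map $\mathsf{E}_{\mathbf{u}}:\mathsf{stors}\,\mathcal{C}\to\mathbb{T}_{\mathbf{u}}$, $(\mathcal{X},\mathcal{Y})\mapsto(\Sigma\mathcal{U}\star\mathcal{X},\ \Sigma\mathcal{Y}\star\Sigma^{-1}\mathcal{W})$; it is an isomorphism of posets which restricts to an isomorphism $\mathsf{stors}\,\mathcal{C}^{-}\to\mathbb{T}_{\mathbf{u}}^{-}$.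 The left HRS-tilt is the map $\mathsf{L}_{\mathbf{u}}:\mathsf{stors}\,\mathcal{H}\to\mathbb{T}_{\mathbf{u}}^{-}$, $(\mathcal{T},\mathcal{F})\mapsto(\mathcal{U}\star\Sigma^{-1}\mathcal{T},\ \mathcal{F}\star\Sigma^{-1}\mathcal{W})$. *)

theory Defs
  imports "HOL-Algebra.Group"
begin

section \<open>Additive categories\<close>

text \<open>
  Objects form a set \<open>Ob\<close> inside a type, and classes of objects (equivalently, full subcategories)
  are subsets of it. The sets \<open>Hom X Y\<close> are not required to be pairwise disjoint; this is why the
  zero morphisms are indexed by objects and triangles carry their three objects.
  \<open>Comp g f\<close> is ``\<open>f\<close> first, then \<open>g\<close>''.
\<close>

record ('o, 'm) precategory =
  Ob :: "'o set"
  Hom :: "'o \<Rightarrow> 'o \<Rightarrow> 'm set"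
  Ident :: "'o \<Rightarrow> 'm"
  Comp :: "'m \<Rightarrow> 'm \<Rightarrow> 'm" (infixl "\<cdot>\<index>" 70)

record ('o, 'm) preadditive = "('o, 'm) precategory" +
  Add :: "'m \<Rightarrow> 'm \<Rightarrow> 'm" (infixl "\<^bold>+\<index>" 65)
  Zero :: "'o \<Rightarrow> 'o \<Rightarrow> 'm"

locale category =
  fixes D :: "('o, 'm, 'z) precategory_scheme" (structure)
  assumes ident_in_Hom: "X \<in> Ob D \<Longrightarrow> Ident D X \<in> Hom D X X"
    and comp_in_Hom:
      "\<lbrakk>X \<in> Ob D; Y \<in> Ob D; Z \<in> Ob D; f \<in> Hom D X Y; g \<in> Hom D Y Z\<rbrakk> \<Longrightarrow> g \<cdot> f \<in> Hom D X Z"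
    and comp_ident: "\<lbrakk>X \<in> Ob D; Y \<in> Ob D; f \<in> Hom D X Y\<rbrakk> \<Longrightarrow> f \<cdot> Ident D X = f"
    and ident_comp: "\<lbrakk>X \<in> Ob D; Y \<in> Ob D; f \<in> Hom D X Y\<rbrakk> \<Longrightarrow> Ident D Y \<cdot> f = f"
    and comp_assoc:
      "\<lbrakk>X \<in> Ob D; Y \<in> Ob D; Z \<in> Ob D; V \<in> Ob D; f \<in> Hom D X Y; g \<in> Hom D Y Z; h \<in> Hom D Z V\<rbrakk>
        \<Longrightarrow> h \<cdot> (g \<cdot> f) = (h \<cdot> g) \<cdot> f"

definition is_iso :: "('o, 'm, 'z) precategory_scheme \<Rightarrow> 'o \<Rightarrow> 'o \<Rightarrow> 'm \<Rightarrow> bool" where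
  "is_iso D X Y f \<longleftrightarrow> f \<in> Hom D X Y \<and>
    (\<exists>g \<in> Hom D Y X. g \<cdot>\<^bsub>D\<^esub> f = Ident D X \<and> f \<cdot>\<^bsub>D\<^esub> g = Ident D Y)"

definition isomorphic :: "('o, 'm, 'z) precategory_scheme \<Rightarrow> 'o \<Rightarrow> 'o \<Rightarrow> bool" where
  "isomorphic D X Y \<longleftrightarrow> (\<exists>f. is_iso D X Y f)"

definition zero_object :: "('o, 'm, 'z) precategory_scheme \<Rightarrow> 'o \<Rightarrow> bool" where
  "zero_object D Z \<longleftrightarrow> Z \<in> Ob D \<and>
    (\<forall>X \<in> Ob D. (\<exists>!f. f \<in> Hom D X Z) \<and> (\<exists>!f. f \<in> Hom D Z X))"

text \<open>
  The additive group \<open>Hom X Y\<close>, written multiplicatively by HOL-Algebra: the negative of a morphism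
  is \<open>inv\<close> in this group.
\<close>

definition hom_group :: "('o, 'm, 'z) preadditive_scheme \<Rightarrow> 'o \<Rightarrow> 'o \<Rightarrow> 'm monoid" where
  "hom_group D X Y = \<lparr>carrier = Hom D X Y, monoid.mult = Add D, one = Zero D X Y\<rparr>"

locale preadditive_category = category D
  for D :: "('o, 'm, 'z) preadditive_scheme" (structure) +
  assumes hom_comm_group: "\<lbrakk>X \<in> Ob D; Y \<in> Ob D\<rbrakk> \<Longrightarrow> comm_group (hom_group D X Y)"
    and comp_add:
      "\<lbrakk>X \<in> Ob D; Y \<in> Ob D; Z \<in> Ob D; f \<in> Hom D X Y; f' \<in> Hom D X Y; g \<in> Hom D Y Z\<rbrakk>
        \<Longrightarrow> g \<cdot> (f \<^bold>+ f') = (g \<cdot> f) \<^bold>+ (g \<cdot> f')"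
    and add_comp:
      "\<lbrakk>X \<in> Ob D; Y \<in> Ob D; Z \<in> Ob D; f \<in> Hom D X Y; g \<in> Hom D Y Z; g' \<in> Hom D Y Z\<rbrakk>
        \<Longrightarrow> (g \<^bold>+ g') \<cdot> f = (g \<cdot> f) \<^bold>+ (g' \<cdot> f)"

locale additive_category = preadditive_category D
  for D :: "('o, 'm, 'z) preadditive_scheme" (structure) +
  assumes zero_object_exists: "\<exists>Z. zero_object D Z"
    and biproduct_exists:
      "\<lbrakk>X \<in> Ob D; Y \<in> Ob D\<rbrakk> \<Longrightarrow>
        \<exists>P \<in> Ob D. \<exists>i \<in> Hom D X P. \<exists>j \<in> Hom D Y P. \<exists>p \<in> Hom D P X. \<exists>q \<in> Hom D P Y.
          p \<cdot> i = Ident D X \<and> q \<cdot> j = Ident D Y \<and>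
          p \<cdot> j = Zero D Y X \<and> q \<cdot> i = Zero D X Y \<and>
          (i \<cdot> p) \<^bold>+ (j \<cdot> q) = Ident D P"


section \<open>Triangulated categories\<close>

text \<open>
  \<open>Shift\<close> and \<open>ShiftM\<close> are the shift automorphism on objects and on morphisms.
  \<open>(X, Y, Z, f, g, h) \<in> Tri D\<close> means that \<open>X \<rightarrow> Y \<rightarrow> Z \<rightarrow> \<Sigma>X\<close>, with morphisms
  \<open>f\<close>, \<open>g\<close>, \<open>h\<close>, is a distinguished triangle.
\<close>

record ('o, 'm) pretriangulated = "('o, 'm) preadditive" +
  Shift :: "'o \<Rightarrow> 'o"
  ShiftM :: "'m \<Rightarrow> 'm"
  Tri :: "('o \<times> 'o \<times> 'o \<times> 'm \<times> 'm \<times> 'm) set"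

locale triangulated_category = additive_category D
  for D :: "('o, 'm, 'z) pretriangulated_scheme" (structure) +
  assumes shift_bij: "bij_betw (Shift D) (Ob D) (Ob D)"
    and shift_hom_bij:
      "\<lbrakk>X \<in> Ob D; Y \<in> Ob D\<rbrakk>
        \<Longrightarrow> bij_betw (ShiftM D) (Hom D X Y) (Hom D (Shift D X) (Shift D Y))"
    and shift_ident: "X \<in> Ob D \<Longrightarrow> ShiftM D (Ident D X) = Ident D (Shift D X)"
    and shift_comp:
      "\<lbrakk>X \<in> Ob D; Y \<in> Ob D; Z \<in> Ob D; f \<in> Hom D X Y; g \<in> Hom D Y Z\<rbrakk>
        \<Longrightarrow> ShiftM D (g \<cdot> f) = ShiftM D g \<cdot> ShiftM D f"
    and shift_add:
      "\<lbrakk>X \<in> Ob D; Y \<in> Ob D; f \<in> Hom D X Y; f' \<in> Hom D X Y\<rbrakk>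
        \<Longrightarrow> ShiftM D (f \<^bold>+ f') = ShiftM D f \<^bold>+ ShiftM D f'"
    and tri_wf:
      "(X, Y, Z, f, g, h) \<in> Tri D \<Longrightarrow>
        X \<in> Ob D \<and> Y \<in> Ob D \<and> Z \<in> Ob D \<and>
        f \<in> Hom D X Y \<and> g \<in> Hom D Y Z \<and> h \<in> Hom D Z (Shift D X)"
    and tri_iso_closed:
      "\<lbrakk>(X, Y, Z, f, g, h) \<in> Tri D; X' \<in> Ob D; Y' \<in> Ob D; Z' \<in> Ob D;
        f' \<in> Hom D X' Y'; g' \<in> Hom D Y' Z'; h' \<in> Hom D Z' (Shift D X');
        is_iso D X X' a; is_iso D Y Y' b; is_iso D Z Z' c;
        b \<cdot> f = f' \<cdot> a; c \<cdot> g = g' \<cdot> b; ShiftM D a \<cdot> h = h' \<cdot> c\<rbrakk>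
        \<Longrightarrow> (X', Y', Z', f', g', h') \<in> Tri D"
    and tri_ident:
      "\<lbrakk>X \<in> Ob D; zero_object D Z\<rbrakk>
        \<Longrightarrow> (X, X, Z, Ident D X, Zero D X Z, Zero D Z (Shift D X)) \<in> Tri D"
    and tri_complete:
      "\<lbrakk>X \<in> Ob D; Y \<in> Ob D; f \<in> Hom D X Y\<rbrakk> \<Longrightarrow> \<exists>Z g h. (X, Y, Z, f, g, h) \<in> Tri D"
    and tri_rotate:
      "\<lbrakk>X \<in> Ob D; Y \<in> Ob D; Z \<in> Ob D;
        f \<in> Hom D X Y; g \<in> Hom D Y Z; h \<in> Hom D Z (Shift D X)\<rbrakk>
        \<Longrightarrow> (X, Y, Z, f, g, h) \<in> Tri D \<longleftrightarrow>
            (Y, Z, Shift D X, g, h, inv\<^bsub>hom_group D (Shift D X) (Shift D Y)\<^esub> (ShiftM D f)) \<in> Tri D"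
    and tri_morphism:
      "\<lbrakk>(X, Y, Z, f, g, h) \<in> Tri D; (X', Y', Z', f', g', h') \<in> Tri D;
        a \<in> Hom D X X'; b \<in> Hom D Y Y'; b \<cdot> f = f' \<cdot> a\<rbrakk>
        \<Longrightarrow> \<exists>c \<in> Hom D Z Z'. c \<cdot> g = g' \<cdot> b \<and> ShiftM D a \<cdot> h = h' \<cdot> c"
    and tri_octahedral:
      "\<lbrakk>(X, Y, Z', f, f', f'') \<in> Tri D; (Y, Z, X', g, g', g'') \<in> Tri D;
        (X, Z, Y', g \<cdot> f, h', h'') \<in> Tri D\<rbrakk>
        \<Longrightarrow> \<exists>u v. (Z', Y', X', u, v, ShiftM D f' \<cdot> g'') \<in> Tri D \<and>
              u \<cdot> f' = h' \<cdot> g \<and> h'' \<cdot> u = f'' \<and>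
              v \<cdot> h' = g' \<and> g'' \<cdot> v = ShiftM D f \<cdot> h''"

text \<open>
  \<open>shift_class\<close> and \<open>unshift_class\<close> are \<open>\<A> \<mapsto> \<Sigma>\<A>\<close> and \<open>\<A> \<mapsto> \<Sigma>\<inverse>\<A>\<close>; the latter is meaningful
  for \<open>\<A> \<subseteq> Ob D\<close> only.
\<close>

definition shift_class :: "('o, 'm, 'z) pretriangulated_scheme \<Rightarrow> 'o set \<Rightarrow> 'o set"
  where "shift_class D \<A> = Shift D ` \<A>"

definition unshift_class :: "('o, 'm, 'z) pretriangulated_scheme \<Rightarrow> 'o set \<Rightarrow> 'o set"
  where "unshift_class D \<A> = inv_into (Ob D) (Shift D) ` \<A>"

definition star ::
  "('o, 'm, 'z) pretriangulated_scheme \<Rightarrow> 'o set \<Rightarrow> 'o set \<Rightarrow> 'o set" (infixl "\<star>\<index>" 75)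
  where "star D \<A> \<B> = {C \<in> Ob D. \<exists>A \<in> \<A>. \<exists>B \<in> \<B>. \<exists>f g h. (A, C, B, f, g, h) \<in> Tri D}"

definition hom_vanishes ::
  "('o, 'm, 'z) preadditive_scheme \<Rightarrow> 'o set \<Rightarrow> 'o set \<Rightarrow> bool"
  where "hom_vanishes D \<A> \<B> \<longleftrightarrow> (\<forall>A \<in> \<A>. \<forall>B \<in> \<B>. Hom D A B = {Zero D A B})"

definition iso_closed_in ::
  "('o, 'm, 'z) precategory_scheme \<Rightarrow> 'o set \<Rightarrow> 'o set \<Rightarrow> bool"
  where "iso_closed_in D \<X> \<A> \<longleftrightarrow> \<A> \<subseteq> \<X> \<and>
    (\<forall>A \<in> \<A>. \<forall>B \<in> \<X>. isomorphic D A B \<longrightarrow> B \<in> \<A>)"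

definition extension_closed ::
  "('o, 'm, 'z) pretriangulated_scheme \<Rightarrow> 'o set \<Rightarrow> bool"
  where "extension_closed D \<X> \<longleftrightarrow> \<X> \<subseteq> Ob D \<and> \<X> \<star>\<^bsub>D\<^esub> \<X> \<subseteq> \<X>"


section \<open>Torsion pairs and t-structures\<close>

definition s_torsion_pair ::
  "('o, 'm, 'z) pretriangulated_scheme \<Rightarrow> 'o set \<Rightarrow> 'o set \<times> 'o set \<Rightarrow> bool"
  where "s_torsion_pair D \<X> = (\<lambda>(\<T>, \<F>).
    extension_closed D \<X> \<and>
    iso_closed_in D \<X> \<T> \<and> iso_closed_in D \<X> \<F> \<and>
    hom_vanishes D \<T> \<F> \<and> hom_vanishes D \<T> (unshift_class D \<F>) \<and>
    \<X> = \<T> \<star>\<^bsub>D\<^esub> \<F>)"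

definition stors ::
  "('o, 'm, 'z) pretriangulated_scheme \<Rightarrow> 'o set \<Rightarrow> ('o set \<times> 'o set) set"
  where "stors D \<X> = {p. s_torsion_pair D \<X> p}"

definition t_structure ::
  "('o, 'm, 'z) pretriangulated_scheme \<Rightarrow> 'o set \<times> 'o set \<Rightarrow> bool"
  where "t_structure D = (\<lambda>(\<U>, \<W>).
    iso_closed_in D (Ob D) \<U> \<and> iso_closed_in D (Ob D) \<W> \<and>
    shift_class D \<U> \<subseteq> \<U> \<and>
    hom_vanishes D \<U> (unshift_class D \<W>) \<and>
    Ob D = \<U> \<star>\<^bsub>D\<^esub> unshift_class D \<W>)"

definition heart ::
  "('o, 'm, 'z) pretriangulated_scheme \<Rightarrow> 'o set \<times> 'o set \<Rightarrow> 'o set"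
  where "heart D = (\<lambda>(\<U>, \<W>). \<U> \<inter> \<W>)"

definition extended_heart ::
  "('o, 'm, 'z) pretriangulated_scheme \<Rightarrow> 'o set \<times> 'o set \<Rightarrow> 'o set"
  where "extended_heart D = (\<lambda>(\<U>, \<W>). \<W> \<inter> unshift_class D \<U>)"

text \<open>
  For a t-structure \<open>u = (\<U>, \<W>)\<close> with extended heart \<open>\<C>\<close>, \<open>tstr_near D u\<close> is the class \<open>\<T>\<^sub>u\<close> of
  t-structures whose aisle lies between \<open>\<Sigma>\<U>\<close> and \<open>\<Sigma>\<inverse>\<U>\<close>, \<open>tstr_near_minus D u\<close> its subclass
  \<open>\<T>\<^sub>u\<^sup>-\<close>, and \<open>stors_minus D u\<close> is \<open>stors \<C>\<^sup>-\<close>. The maps below are total functions on pairs, to be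
  considered only on the appropriate sets of pairs.
\<close>

definition tstr_near ::
  "('o, 'm, 'z) pretriangulated_scheme \<Rightarrow> 'o set \<times> 'o set \<Rightarrow> ('o set \<times> 'o set) set"
  where "tstr_near D = (\<lambda>(\<U>, \<W>). {(\<U>', \<W>'). t_structure D (\<U>', \<W>') \<and>
    shift_class D \<U> \<subseteq> \<U>' \<and> \<U>' \<subseteq> unshift_class D \<U>})"

definition tstr_near_minus ::
  "('o, 'm, 'z) pretriangulated_scheme \<Rightarrow> 'o set \<times> 'o set \<Rightarrow> ('o set \<times> 'o set) set"
  where "tstr_near_minus D = (\<lambda>(\<U>, \<W>). {(\<U>', \<W>') \<in> tstr_near D (\<U>, \<W>). \<U> \<subseteq> \<U>'})"

definition stors_minus ::
  "('o, 'm, 'z) pretriangulated_scheme \<Rightarrow> 'o set \<times> 'o set \<Rightarrow> ('o set \<times> 'o set) set"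
  where "stors_minus D u = {(\<X>, \<Y>) \<in> stors D (extended_heart D u). heart D u \<subseteq> \<X>}"

definition extended_tilt ::
  "('o, 'm, 'z) pretriangulated_scheme \<Rightarrow> 'o set \<times> 'o set \<Rightarrow> 'o set \<times> 'o set \<Rightarrow> 'o set \<times> 'o set"
  where "extended_tilt D = (\<lambda>(\<U>, \<W>) (\<X>, \<Y>).
    (shift_class D \<U> \<star>\<^bsub>D\<^esub> \<X>, shift_class D \<Y> \<star>\<^bsub>D\<^esub> unshift_class D \<W>))"

definition left_HRS_tilt ::
  "('o, 'm, 'z) pretriangulated_scheme \<Rightarrow> 'o set \<times> 'o set \<Rightarrow> 'o set \<times> 'o set \<Rightarrow> 'o set \<times> 'o set"
  where "left_HRS_tilt D = (\<lambda>(\<U>, \<W>) (\<T>, \<F>).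
    (\<U> \<star>\<^bsub>D\<^esub> unshift_class D \<T>, \<F> \<star>\<^bsub>D\<^esub> unshift_class D \<W>))"

definition mu_minus ::
  "('o, 'm, 'z) pretriangulated_scheme \<Rightarrow> 'o set \<times> 'o set \<Rightarrow> 'o set \<times> 'o set \<Rightarrow> 'o set \<times> 'o set"
  where "mu_minus D u = (\<lambda>(\<T>, \<F>). (heart D u \<star>\<^bsub>D\<^esub> \<T>, \<F>))"

definition lambda_minus ::
  "('o, 'm, 'z) pretriangulated_scheme \<Rightarrow> 'o set \<times> 'o set \<Rightarrow> 'o set \<times> 'o set \<Rightarrow> 'o set \<times> 'o set"
  where "lambda_minus D u = (\<lambda>(\<X>, \<Y>). (\<X> \<inter> unshift_class D (heart D u), \<Y>))"

definition unshift_pair ::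
  "('o, 'm, 'z) pretriangulated_scheme \<Rightarrow> 'o set \<times> 'o set \<Rightarrow> 'o set \<times> 'o set"
  where "unshift_pair D = (\<lambda>(\<T>, \<F>). (unshift_class D \<T>, unshift_class D \<F>))"


section \<open>Posets of pairs\<close>

definition fst_order :: "('a set \<times> 'b set) set \<Rightarrow> (('a set \<times> 'b set) \<times> ('a set \<times> 'b set)) set"
  where "fst_order P = {(p, q). p \<in> P \<and> q \<in> P \<and> fst p \<subseteq> fst q}"

definition poset_iso ::
  "'a set \<Rightarrow> ('a \<times> 'a) set \<Rightarrow> 'b set \<Rightarrow> ('b \<times> 'b) set \<Rightarrow> ('a \<Rightarrow> 'b) \<Rightarrow> bool"
  where "poset_iso A r B s f \<longleftrightarrow>
    partial_order_on A r \<and> partial_order_on B s \<and> bij_betw f A B \<and>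
    (\<forall>x \<in> A. \<forall>y \<in> A. (x, y) \<in> r \<longleftrightarrow> (f x, f y) \<in> s)"

abbreviation pairs_iso ::
  "('a set \<times> 'b set) set \<Rightarrow> ('c set \<times> 'd set) set \<Rightarrow> ('a set \<times> 'b set \<Rightarrow> 'c set \<times> 'd set) \<Rightarrow> bool"
  where "pairs_iso P Q f \<equiv> poset_iso P (fst_order P) Q (fst_order Q) f"

end

theory Submission
  imports Defs
begin

text \<open>
  A \<open>t\<close>-structure \<open>(\<U>, \<W>)\<close> is the same thing as an \<open>s\<close>-torsion pair \<open>(\<U>, \<Sigma>\<inverse>\<W>)\<close> in the whole category.
  If \<open>(\<T>\<^sub>1, \<F>\<^sub>1) \<le> (\<T>\<^sub>2, \<F>\<^sub>2)\<close> are \<open>s\<close>-torsion pairs in an extension-closed class \<open>\<X>\<close>, then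
  \<open>(\<A>, \<B>) \<mapsto> (\<T>\<^sub>1 \<star> \<A>, \<B> \<star> \<F>\<^sub>2)\<close> is an isomorphism from \<open>stors (\<T>\<^sub>2 \<inter> \<F>\<^sub>1)\<close> onto the interval between the
  two pairs, with inverse \<open>(\<T>, \<F>) \<mapsto> (\<T> \<inter> \<F>\<^sub>1, \<F> \<inter> \<T>\<^sub>2)\<close>. Taking the whole category and the pairs with
  torsion classes \<open>\<Sigma>\<U>\<close> and \<open>\<Sigma>\<inverse>\<U>\<close> gives the extended tilt; taking \<open>\<X> = \<C>\<close> and the pairs
  \<open>(\<H>, \<Sigma>\<inverse>\<H>)\<close> and \<open>(\<C>, 0)\<close> gives \<open>\<mu>\<^sup>-\<close>. Since \<open>\<Sigma>\<U> \<star> \<H> = \<U>\<close>, associativity of \<open>\<star>\<close> identifies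
  the composite with the left HRS-tilt.
\<close>

section \<open>Triangles up to isomorphism\<close>

lemma zero_object_in_Ob: "zero_object D Z \<Longrightarrow> Z \<in> Ob D"
  by (simp add: zero_object_def)

text \<open>\<open>hom_vanishes\<close> speaks about classes. The exact sequences of Hom groups are
  applied to single objects, so the condition is isolated for one pair.\<close>

definition null_hom :: "('o, 'm, 'z) preadditive_scheme \<Rightarrow> 'o \<Rightarrow> 'o \<Rightarrow> bool"
  where "null_hom D A B \<longleftrightarrow> Hom D A B = {Zero D A B}"

lemma hom_vanishes_iff: "hom_vanishes D \<A> \<B> \<longleftrightarrow> (\<forall>A\<in>\<A>. \<forall>B\<in>\<B>. null_hom D A B)"
  by (simp add: hom_vanishes_def null_hom_def)

text \<open>\<open>star\<close> asks only whether a triangle on given objects exists. Once the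
  morphisms are forgotten, the signs introduced by rotation are no longer visible.\<close>

definition dtri :: "('o, 'm, 'z) pretriangulated_scheme \<Rightarrow> 'o \<Rightarrow> 'o \<Rightarrow> 'o \<Rightarrow> bool"
  where "dtri D A C B \<longleftrightarrow> (\<exists>f g h. (A, C, B, f, g, h) \<in> Tri D)"

lemma mem_star_iff: "C \<in> \<A> \<star>\<^bsub>D\<^esub> \<B> \<longleftrightarrow> C \<in> Ob D \<and> (\<exists>A\<in>\<A>. \<exists>B\<in>\<B>. dtri D A C B)"
  by (simp add: star_def dtri_def)

lemma starE:
  assumes "C \<in> \<A> \<star>\<^bsub>D\<^esub> \<B>"
  obtains A B where "A \<in> \<A>" "B \<in> \<B>" "C \<in> Ob D" "dtri D A C B"
  using assms by (auto simp: mem_star_iff)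

lemma star_mono: "\<A> \<subseteq> \<A>' \<Longrightarrow> \<B> \<subseteq> \<B>' \<Longrightarrow> \<A> \<star>\<^bsub>D\<^esub> \<B> \<subseteq> \<A>' \<star>\<^bsub>D\<^esub> \<B>'"
  unfolding star_def by blast

lemma isomorphic_sym: "isomorphic D X Y \<Longrightarrow> isomorphic D Y X"
  unfolding isomorphic_def is_iso_def by metis

abbreviation replete :: "('o, 'm, 'z) precategory_scheme \<Rightarrow> 'o set \<Rightarrow> bool"
  where "replete D \<equiv> iso_closed_in D (Ob D)"

lemma repleteD: "replete D \<A> \<Longrightarrow> A \<in> \<A> \<Longrightarrow> isomorphic D A B \<Longrightarrow> B \<in> Ob D \<Longrightarrow> B \<in> \<A>"
  by (auto simp: iso_closed_in_def)

lemma replete_subset: "replete D \<A> \<Longrightarrow> \<A> \<subseteq> Ob D"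
  by (auto simp: iso_closed_in_def)

lemma replete_Int: "replete D \<A> \<Longrightarrow> replete D \<B> \<Longrightarrow> replete D (\<A> \<inter> \<B>)"
  by (auto simp: iso_closed_in_def)

context category
begin

lemma isomorphic_refl: "X \<in> Ob D \<Longrightarrow> isomorphic D X X"
  unfolding isomorphic_def is_iso_def
  by (metis comp_ident ident_in_Hom)

text \<open>Both the retraction and the section equal r f s. They may come from different sources:
  for the middle map of a triangle, one from a weak cokernel and the other from a weak
  kernel.\<close>

lemma isomorphic_if_split:
  assumes "X \<in> Ob D" "Y \<in> Ob D" "f \<in> Hom D X Y" "r \<in> Hom D Y X" "s \<in> Hom D Y X"
    and "r \<cdot> f = Ident D X" "f \<cdot> s = Ident D Y"
  shows "isomorphic D X Y"
proof -
  have "r = r \<cdot> (f \<cdot> s)" using assms comp_ident[of Y X r] by simp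
  also have "\<dots> = (r \<cdot> f) \<cdot> s" using assms comp_assoc[of Y X Y X s f r] by simp
  also have "\<dots> = s" using assms ident_comp[of Y X s] by simp
  finally show ?thesis
    using assms unfolding isomorphic_def is_iso_def by blast
qed

end

section \<open>Additive calculus and zero objects\<close>

context preadditive_category
begin

abbreviation neg :: "'o \<Rightarrow> 'o \<Rightarrow> 'm \<Rightarrow> 'm"
  where "neg X Y \<equiv> m_inv (hom_group D X Y)"

lemma hom_group_simps [simp]:
  "carrier (hom_group D X Y) = Hom D X Y"
  "mult (hom_group D X Y) = Add D"
  "one (hom_group D X Y) = Zero D X Y"
  by (simp_all add: hom_group_def)

context
  fixes X Y
  assumes XY: "X \<in> Ob D" "Y \<in> Ob D"
begin

interpretation G: comm_group "hom_group D X Y"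
  using XY by (rule hom_comm_group)

lemma zero_in_Hom: "Zero D X Y \<in> Hom D X Y"
  using G.one_closed by simp

lemma neg_in_Hom: "f \<in> Hom D X Y \<Longrightarrow> neg X Y f \<in> Hom D X Y"
  using G.inv_closed by simp

lemma neg_neg: "f \<in> Hom D X Y \<Longrightarrow> neg X Y (neg X Y f) = f"
  using G.inv_inv by simp

lemma add_neg: "f \<in> Hom D X Y \<Longrightarrow> f \<^bold>+ neg X Y f = Zero D X Y"
  using G.r_inv by simp

lemma add_zero: "f \<in> Hom D X Y \<Longrightarrow> f \<^bold>+ Zero D X Y = f"
  using G.r_one by simp

lemma zero_if_idem: "f \<in> Hom D X Y \<Longrightarrow> f \<^bold>+ f = f \<Longrightarrow> f = Zero D X Y"
  using G.r_cancel_one by (metis hom_group_simps)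

lemma neg_unique: "f \<in> Hom D X Y \<Longrightarrow> g \<in> Hom D X Y \<Longrightarrow> f \<^bold>+ g = Zero D X Y \<Longrightarrow> neg X Y f = g"
  using G.inv_unique'[of f g] G.m_comm[of f g] by simp

end

text \<open>By bilinearity g 0 = g (0 + 0) is an idempotent of the group Hom X Z, hence
  zero.\<close>

lemma comp_zero:
  assumes "X \<in> Ob D" "Y \<in> Ob D" "Z \<in> Ob D" "g \<in> Hom D Y Z"
  shows "g \<cdot> Zero D X Y = Zero D X Z"
  using assms comp_add[of X Y Z "Zero D X Y" "Zero D X Y" g]
  by (metis add_zero comp_in_Hom zero_if_idem zero_in_Hom)

lemma zero_comp:
  assumes "X \<in> Ob D" "Y \<in> Ob D" "Z \<in> Ob D" "f \<in> Hom D X Y"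
  shows "Zero D Y Z \<cdot> f = Zero D X Z"
  using assms add_comp[of X Y Z f "Zero D Y Z" "Zero D Y Z"]
  by (metis add_zero comp_in_Hom zero_if_idem zero_in_Hom)

lemma comp_neg:
  assumes "X \<in> Ob D" "Y \<in> Ob D" "Z \<in> Ob D" "f \<in> Hom D X Y" "g \<in> Hom D Y Z"
  shows "g \<cdot> neg X Y f = neg X Z (g \<cdot> f)"
proof -
  note n = neg_in_Hom[OF assms(1,2,4)]
  have "g \<cdot> f \<^bold>+ g \<cdot> neg X Y f = Zero D X Z"
    using comp_add[OF assms(1-4) n assms(5)] add_neg[OF assms(1,2,4)] comp_zero[OF assms(1-3,5)] by simp
  then show ?thesis
    using neg_unique[OF assms(1,3) comp_in_Hom[OF assms] comp_in_Hom[OF assms(1-3) n assms(5)]] by simp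
qed

lemma neg_comp:
  assumes "X \<in> Ob D" "Y \<in> Ob D" "Z \<in> Ob D" "f \<in> Hom D X Y" "g \<in> Hom D Y Z"
  shows "neg Y Z g \<cdot> f = neg X Z (g \<cdot> f)"
proof -
  note n = neg_in_Hom[OF assms(2,3,5)]
  have "g \<cdot> f \<^bold>+ neg Y Z g \<cdot> f = Zero D X Z"
    using add_comp[OF assms(1-5) n] add_neg[OF assms(2,3,5)] zero_comp[OF assms(1-4)] by simp
  then show ?thesis
    using neg_unique[OF assms(1,3) comp_in_Hom[OF assms] comp_in_Hom[OF assms(1-4) n]] by simp
qed

lemma null_hom_iff:
  "X \<in> Ob D \<Longrightarrow> Y \<in> Ob D \<Longrightarrow> null_hom D X Y \<longleftrightarrow> (\<forall>f\<in>Hom D X Y. f = Zero D X Y)"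
  unfolding null_hom_def using zero_in_Hom by blast

lemma null_hom_if_ex1:
  "X \<in> Ob D \<Longrightarrow> Y \<in> Ob D \<Longrightarrow> \<exists>!f. f \<in> Hom D X Y \<Longrightarrow> null_hom D X Y"
  using zero_in_Hom[of X Y] null_hom_iff[of X Y] by metis

lemma null_hom_from_zero: "zero_object D Z \<Longrightarrow> X \<in> Ob D \<Longrightarrow> null_hom D Z X"
  by (simp add: zero_object_def null_hom_if_ex1)

lemma null_hom_to_zero: "zero_object D Z \<Longrightarrow> X \<in> Ob D \<Longrightarrow> null_hom D X Z"
  by (simp add: zero_object_def null_hom_if_ex1)

text \<open>If the endomorphisms of Z vanish, its identity is zero, and every morphism into or out
  of Z absorbs that identity. The criterion involves a single Hom set and is therefore easy to
  transport along the shift.\<close>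

lemma zero_object_iff: "zero_object D Z \<longleftrightarrow> Z \<in> Ob D \<and> null_hom D Z Z"
proof
  assume "zero_object D Z"
  then show "Z \<in> Ob D \<and> null_hom D Z Z"
    by (simp add: zero_object_in_Ob null_hom_from_zero)
next
  assume "Z \<in> Ob D \<and> null_hom D Z Z"
  then have Z: "Z \<in> Ob D" and "null_hom D Z Z" by auto
  then have id: "Ident D Z = Zero D Z Z"
    using ident_in_Hom[OF Z] by (simp add: null_hom_def)
  have to: "f = Zero D X Z" if "X \<in> Ob D" "f \<in> Hom D X Z" for X f
    using ident_comp[OF that(1) Z that(2)] zero_comp[OF that(1) Z Z that(2)] id by simp
  have out: "f = Zero D Z X" if "X \<in> Ob D" "f \<in> Hom D Z X" for X f
    using comp_ident[OF Z that] comp_zero[OF Z Z that] id by simp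
  show "zero_object D Z"
    unfolding zero_object_def
    by (intro conjI ballI ex1I[of _ "Zero D _ _"]) (assumption | rule Z zero_in_Hom to out)+
qed

lemma zero_objects_isomorphic:
  assumes "zero_object D Z" "zero_object D Z'"
  shows "isomorphic D Z Z'"
proof -
  have Ob: "Z \<in> Ob D" "Z' \<in> Ob D" using assms by (auto simp: zero_object_in_Ob)
  have zero: "Zero D Z Z' \<in> Hom D Z Z'" "Zero D Z' Z \<in> Hom D Z' Z"
    by (simp_all add: Ob zero_in_Hom)
  have unique: "f = Ident D X" if "f \<in> Hom D X X" "zero_object D X" "X \<in> Ob D" for f X
    using that null_hom_from_zero[of X X] ident_in_Hom[of X] by (simp add: null_hom_def)
  show ?thesis
    by (rule isomorphic_if_split[OF Ob zero zero(2)
        unique[OF comp_in_Hom[OF Ob Ob(1) zero] assms(1) Ob(1)]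
        unique[OF comp_in_Hom[OF Ob(2,1,2) zero(2,1)] assms(2) Ob(2)]])
qed

lemma replete_zero_object:
  "replete D \<A> \<Longrightarrow> Z \<in> \<A> \<Longrightarrow> zero_object D Z \<Longrightarrow> zero_object D Z' \<Longrightarrow> Z' \<in> \<A>"
  by (rule repleteD[OF _ _ zero_objects_isomorphic zero_object_in_Ob])

lemma zero_object_isomorphic:
  assumes "zero_object D Z" "isomorphic D Z X" "X \<in> Ob D"
  shows "zero_object D X"
proof -
  obtain f g where fg: "f \<in> Hom D Z X" "g \<in> Hom D X Z" "f \<cdot> g = Ident D X"
    using assms(2) unfolding isomorphic_def is_iso_def by blast
  have Z: "Z \<in> Ob D" using assms by (simp add: zero_object_in_Ob)
  have "f = Zero D Z X"
    using null_hom_from_zero[OF assms(1,3)] fg(1) by (simp add: null_hom_def)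
  then have id: "Ident D X = Zero D X X"
    using fg(2,3) zero_comp[OF assms(3) Z assms(3)] by simp
  have "k = Zero D X X" if k: "k \<in> Hom D X X" for k
    using ident_comp[OF assms(3) assms(3) k] zero_comp[OF assms(3) assms(3) assms(3) k] id by simp
  then have "null_hom D X X"
    using null_hom_iff[OF assms(3) assms(3)] by blast
  then show ?thesis
    using assms(3) by (simp add: zero_object_iff)
qed

end

section \<open>The shift automorphism on Hom sets and isomorphisms\<close>

context triangulated_category
begin

abbreviation shift :: "'o \<Rightarrow> 'o" ("\<sigma>")
  where "\<sigma> \<equiv> Shift D"

abbreviation unshift :: "'o \<Rightarrow> 'o" ("\<tau>")
  where "\<tau> \<equiv> inv_into (Ob D) (Shift D)"

lemma shift_in_Ob: "X \<in> Ob D \<Longrightarrow> \<sigma> X \<in> Ob D"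
  using shift_bij bij_betwE by blast

lemma unshift_in_Ob: "X \<in> Ob D \<Longrightarrow> \<tau> X \<in> Ob D"
  using shift_bij by (metis bij_betw_imp_surj_on inv_into_into)

lemma shift_unshift: "X \<in> Ob D \<Longrightarrow> \<sigma> (\<tau> X) = X"
  using shift_bij bij_betw_inv_into_right by metis

lemma unshift_shift: "X \<in> Ob D \<Longrightarrow> \<tau> (\<sigma> X) = X"
  using shift_bij bij_betw_inv_into_left by metis

lemma shiftM_in_Hom:
  "X \<in> Ob D \<Longrightarrow> Y \<in> Ob D \<Longrightarrow> f \<in> Hom D X Y \<Longrightarrow> ShiftM D f \<in> Hom D (\<sigma> X) (\<sigma> Y)"
  using shift_hom_bij bij_betwE by blast

lemma shiftM_surj:
  assumes "X \<in> Ob D" "Y \<in> Ob D" "f \<in> Hom D (\<sigma> X) (\<sigma> Y)"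
  obtains f' where "f' \<in> Hom D X Y" "ShiftM D f' = f"
  using assms shift_hom_bij[of X Y] by (metis bij_betw_imp_surj_on imageE)

lemma shiftM_inj:
  "X \<in> Ob D \<Longrightarrow> Y \<in> Ob D \<Longrightarrow> f \<in> Hom D X Y \<Longrightarrow> g \<in> Hom D X Y \<Longrightarrow> ShiftM D f = ShiftM D g \<Longrightarrow> f = g"
  using shift_hom_bij[of X Y] by (meson bij_betw_imp_inj_on inj_onD)

lemma null_hom_shift_iff:
  assumes "X \<in> Ob D" "Y \<in> Ob D"
  shows "null_hom D (\<sigma> X) (\<sigma> Y) \<longleftrightarrow> null_hom D X Y"
proof -
  note Ob = assms shift_in_Ob[OF assms(1)] shift_in_Ob[OF assms(2)]
  \<comment> \<open>Phrased as "any two morphisms agree", triviality does not mention the zero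
    morphism, so a bijection of Hom sets is enough to transport it.\<close>
  have iff: "null_hom D A B \<longleftrightarrow> (\<forall>f\<in>Hom D A B. \<forall>g\<in>Hom D A B. f = g)" if "A \<in> Ob D" "B \<in> Ob D" for A B
    using zero_in_Hom[OF that] unfolding null_hom_iff[OF that] by metis
  have "inj_on (ShiftM D) (Hom D X Y)" "Hom D (\<sigma> X) (\<sigma> Y) = ShiftM D ` Hom D X Y"
    using shift_hom_bij[OF assms] by (auto simp: bij_betw_def)
  then show ?thesis
    unfolding iff[OF Ob(1,2)] iff[OF Ob(3,4)] by (simp add: inj_on_eq_iff)
qed

lemma zero_object_shift: "zero_object D Z \<Longrightarrow> zero_object D (\<sigma> Z)"
  by (simp add: zero_object_iff null_hom_shift_iff shift_in_Ob)

lemma isomorphic_shift: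
  assumes "X \<in> Ob D" "Y \<in> Ob D" "isomorphic D X Y"
  shows "isomorphic D (\<sigma> X) (\<sigma> Y)"
proof -
  obtain f g where fg: "f \<in> Hom D X Y" "g \<in> Hom D Y X" "g \<cdot> f = Ident D X" "f \<cdot> g = Ident D Y"
    using assms(3) unfolding isomorphic_def is_iso_def by blast
  have "ShiftM D g \<cdot> ShiftM D f = Ident D (\<sigma> X)"
    using fg assms shift_comp[of X Y X f g] shift_ident[of X] by simp
  moreover have "ShiftM D f \<cdot> ShiftM D g = Ident D (\<sigma> Y)"
    using fg assms shift_comp[of Y X Y g f] shift_ident[of Y] by simp
  ultimately show ?thesis
    using fg assms shiftM_in_Hom unfolding isomorphic_def is_iso_def by blast
qed

text \<open>The shift is full and faithful: both inverse maps lift, and the two identities may be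
  checked after applying \<open>ShiftM\<close>.\<close>

lemma isomorphic_unshift:
  assumes "X \<in> Ob D" "Y \<in> Ob D" "isomorphic D (\<sigma> X) (\<sigma> Y)"
  shows "isomorphic D X Y"
proof -
  obtain f g where fg: "f \<in> Hom D (\<sigma> X) (\<sigma> Y)" "g \<in> Hom D (\<sigma> Y) (\<sigma> X)"
      "g \<cdot> f = Ident D (\<sigma> X)" "f \<cdot> g = Ident D (\<sigma> Y)"
    using assms(3) unfolding isomorphic_def is_iso_def by blast
  obtain f' where f': "f' \<in> Hom D X Y" "ShiftM D f' = f"
    using assms fg(1) shiftM_surj by blast
  obtain g' where g': "g' \<in> Hom D Y X" "ShiftM D g' = g"
    using assms fg(2) shiftM_surj by blast
  have "g' \<cdot> f' = Ident D X"
    by (rule shiftM_inj[of X X])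
      (use assms fg f' g' in \<open>auto simp: shift_comp[of X Y X] shift_ident intro: comp_in_Hom[of X Y] ident_in_Hom\<close>)
  moreover have "f' \<cdot> g' = Ident D Y"
    by (rule shiftM_inj[of Y Y])
      (use assms fg f' g' in \<open>auto simp: shift_comp[of Y X Y] shift_ident intro: comp_in_Hom[of Y X] ident_in_Hom\<close>)
  ultimately show ?thesis
    using f' g' unfolding isomorphic_def is_iso_def by blast
qed

section \<open>Distinguished triangles as a relation on objects\<close>

lemma dtri_wf: "dtri D A C B \<Longrightarrow> A \<in> Ob D \<and> C \<in> Ob D \<and> B \<in> Ob D"
  unfolding dtri_def using tri_wf by blast

lemma dtri_rotate_iff:
  assumes "A \<in> Ob D"
  shows "dtri D C B (\<sigma> A) \<longleftrightarrow> dtri D A C B"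
proof
  assume "dtri D A C B"
  then show "dtri D C B (\<sigma> A)"
    unfolding dtri_def using tri_rotate tri_wf by blast
next
  assume "dtri D C B (\<sigma> A)"
  then obtain g h k where T: "(C, B, \<sigma> A, g, h, k) \<in> Tri D" by (auto simp: dtri_def)
  then have wf: "C \<in> Ob D" "B \<in> Ob D" "\<sigma> A \<in> Ob D" "\<sigma> C \<in> Ob D"
      "g \<in> Hom D C B" "h \<in> Hom D B (\<sigma> A)" "k \<in> Hom D (\<sigma> A) (\<sigma> C)"
    using tri_wf[OF T] shift_in_Ob by auto
  \<comment> \<open>Rotation puts minus Sigma f in the last place, so Sigma f has to be minus k; the
    two signs then cancel.\<close>
  obtain f where "f \<in> Hom D A C" "ShiftM D f = neg (\<sigma> A) (\<sigma> C) k"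
    using shiftM_surj[OF assms wf(1)] neg_in_Hom wf by metis
  then have "(A, C, B, f, g, h) \<in> Tri D"
    using tri_rotate[of A C B f g h] assms wf T neg_neg by simp
  then show "dtri D A C B" by (auto simp: dtri_def)
qed

text \<open>Three rotations shift every term once.\<close>

lemma dtri_shift_iff:
  assumes "A \<in> Ob D" "B \<in> Ob D" "C \<in> Ob D"
  shows "dtri D (\<sigma> A) (\<sigma> C) (\<sigma> B) \<longleftrightarrow> dtri D A C B"
  using assms dtri_rotate_iff by simp

lemma dtri_isomorphic:
  assumes T: "dtri D A C B" and Ob: "A' \<in> Ob D" "C' \<in> Ob D" "B' \<in> Ob D"
    and iso: "isomorphic D A A'" "isomorphic D C C'" "isomorphic D B B'"
  shows "dtri D A' C' B'"
proof -
  obtain f g h where t: "(A, C, B, f, g, h) \<in> Tri D" using T by (auto simp: dtri_def)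
  have wf: "A \<in> Ob D" "C \<in> Ob D" "B \<in> Ob D" "f \<in> Hom D A C" "g \<in> Hom D C B" "h \<in> Hom D B (\<sigma> A)"
    using tri_wf[OF t] by auto
  obtain a a' where a: "is_iso D A A' a" "a \<in> Hom D A A'" "a' \<in> Hom D A' A" "a' \<cdot> a = Ident D A"
    using iso(1) by (auto simp: isomorphic_def is_iso_def)
  obtain b b' where b: "is_iso D C C' b" "b \<in> Hom D C C'" "b' \<in> Hom D C' C" "b' \<cdot> b = Ident D C"
    using iso(2) by (auto simp: isomorphic_def is_iso_def)
  obtain c c' where c: "is_iso D B B' c" "c \<in> Hom D B B'" "c' \<in> Hom D B' B" "c' \<cdot> c = Ident D B"
    using iso(3) by (auto simp: isomorphic_def is_iso_def)
  have cancel: "(k \<cdot> x') \<cdot> x = k"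
    if "X \<in> Ob D" "X' \<in> Ob D" "Y \<in> Ob D" "x \<in> Hom D X X'" "x' \<in> Hom D X' X"
      "x' \<cdot> x = Ident D X" "k \<in> Hom D X Y" for k x x' X X' Y
    using that comp_assoc[of X X' X Y x x' k] comp_ident[of X Y k] by simp
  note S = shift_in_Ob[OF wf(1)] shift_in_Ob[OF Ob(1)]
  have bf: "b \<cdot> f \<in> Hom D A C'" using wf Ob b comp_in_Hom[of A C C' f b] by simp
  have cg: "c \<cdot> g \<in> Hom D C B'" using wf Ob c comp_in_Hom[of C B B' g c] by simp
  have ah: "ShiftM D a \<cdot> h \<in> Hom D B (\<sigma> A')" using wf Ob a S comp_in_Hom[of B "\<sigma> A" "\<sigma> A'"] shiftM_in_Hom[of A A' a] by simp
  \<comment> \<open>The new maps are the old ones conjugated by the isomorphisms. The squares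
    commute because a' a, b' b and c' c are identities.\<close>
  have "(A', C', B', (b \<cdot> f) \<cdot> a', (c \<cdot> g) \<cdot> b', (ShiftM D a \<cdot> h) \<cdot> c') \<in> Tri D"
  proof (rule tri_iso_closed[OF t Ob _ _ _ a(1) b(1) c(1)])
    show "b \<cdot> f \<cdot> a' \<in> Hom D A' C'" using bf a wf Ob comp_in_Hom[of A' A C'] by simp
    show "c \<cdot> g \<cdot> b' \<in> Hom D C' B'" using cg b wf Ob comp_in_Hom[of C' C B'] by simp
    show "ShiftM D a \<cdot> h \<cdot> c' \<in> Hom D B' (\<sigma> A')" using ah c wf Ob S comp_in_Hom[of B' B "\<sigma> A'"] by simp
    show "b \<cdot> f = b \<cdot> f \<cdot> a' \<cdot> a" using cancel[of A A' C' a a'] a wf Ob bf by simp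
    show "c \<cdot> g = c \<cdot> g \<cdot> b' \<cdot> b" using cancel[of C C' B' b b'] b wf Ob cg by simp
    show "ShiftM D a \<cdot> h = ShiftM D a \<cdot> h \<cdot> c' \<cdot> c" using cancel[of B B' "\<sigma> A'" c c'] c wf Ob S ah by simp
  qed
  then show ?thesis by (auto simp: dtri_def)
qed

lemma dtri_self_zero: "X \<in> Ob D \<Longrightarrow> zero_object D Z \<Longrightarrow> dtri D X X Z"
  unfolding dtri_def using tri_ident by blast

lemma dtri_zero_self: "X \<in> Ob D \<Longrightarrow> zero_object D Z \<Longrightarrow> dtri D Z X X"
  using dtri_self_zero[of X "\<sigma> Z"] by (simp add: zero_object_shift zero_object_in_Ob dtri_rotate_iff)

lemma dtri_octahedral:
  assumes "dtri D X Y Z'" "dtri D Y Z X'"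
  obtains Y' where "dtri D X Z Y'" "dtri D Z' Y' X'"
proof -
  obtain f f' f'' g g' g'' where t: "(X, Y, Z', f, f', f'') \<in> Tri D" "(Y, Z, X', g, g', g'') \<in> Tri D"
    using assms by (auto simp: dtri_def)
  have "X \<in> Ob D" "Z \<in> Ob D" "g \<cdot> f \<in> Hom D X Z"
    using tri_wf[OF t(1)] tri_wf[OF t(2)] comp_in_Hom by auto
  \<comment> \<open>Any cone of the composite serves as Y'; the octahedral axiom links it to the
    cones of the two factors.\<close>
  then obtain Y' h' h'' where t': "(X, Z, Y', g \<cdot> f, h', h'') \<in> Tri D"
    using tri_complete by blast
  then show ?thesis
    using that[of Y'] tri_octahedral[OF t t'] unfolding dtri_def by blast
qed

section \<open>Weak kernels and cokernels, and exactness of Hom\<close>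

lemma tri_weak_cokernel:
  assumes t: "(X, Y, Z, f, g, h) \<in> Tri D" and Q: "Q \<in> Ob D"
    and p: "p \<in> Hom D Y Q" "p \<cdot> f = Zero D X Q"
  obtains c where "c \<in> Hom D Z Q" "c \<cdot> g = p"
proof -
  have wf: "X \<in> Ob D" "Y \<in> Ob D" "Z \<in> Ob D" "f \<in> Hom D X Y" using tri_wf[OF t] by auto
  obtain N where N: "zero_object D N" using zero_object_exists by blast
  have Ob: "N \<in> Ob D" "\<sigma> N \<in> Ob D" "\<sigma> Q \<in> Ob D" "zero_object D (\<sigma> N)"
    using N Q by (auto simp: zero_object_in_Ob zero_object_shift shift_in_Ob)
  \<comment> \<open>Out of the zero object \<open>\<sigma> N\<close> the sign of the rotation axiom
    is invisible. The identity triangle on Q can thus be rotated back to N -> Q -> Q, and p extends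
    to a morphism of triangles into it.\<close>
  have "neg (\<sigma> N) (\<sigma> Q) (ShiftM D (Zero D N Q)) \<in> Hom D (\<sigma> N) (\<sigma> Q)"
    using Ob Q by (intro neg_in_Hom shiftM_in_Hom zero_in_Hom)
  then have "neg (\<sigma> N) (\<sigma> Q) (ShiftM D (Zero D N Q)) = Zero D (\<sigma> N) (\<sigma> Q)"
    using null_hom_from_zero Ob unfolding null_hom_def by blast
  then have "(N, Q, Q, Zero D N Q, Ident D Q, Zero D Q (\<sigma> N)) \<in> Tri D"
    using tri_rotate[of N Q Q] tri_ident[of Q "\<sigma> N"] Ob Q by (simp add: zero_in_Hom ident_in_Hom)
  moreover have "p \<cdot> f = Zero D N Q \<cdot> Zero D X N"
    using p wf Ob Q comp_zero zero_in_Hom by metis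
  ultimately obtain c where "c \<in> Hom D Z Q" "c \<cdot> g = Ident D Q \<cdot> p"
    using tri_morphism[OF t _ zero_in_Hom[OF wf(1) Ob(1)] p(1)] by blast
  then show ?thesis using that ident_comp p(1) Q wf by metis
qed

lemma tri_weak_kernel:
  assumes t: "(X, Y, Z, f, g, h) \<in> Tri D" and Q: "Q \<in> Ob D"
    and p: "p \<in> Hom D Q Y" "g \<cdot> p = Zero D Q Z"
  obtains c where "c \<in> Hom D Q X" "f \<cdot> c = p"
proof -
  have wf: "X \<in> Ob D" "Y \<in> Ob D" "Z \<in> Ob D"
      "f \<in> Hom D X Y" "g \<in> Hom D Y Z" "h \<in> Hom D Z (\<sigma> X)"
    using tri_wf[OF t] by auto
  obtain N where N: "zero_object D N" using zero_object_exists by blast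
  have Ob: "N \<in> Ob D" "\<sigma> X \<in> Ob D" "\<sigma> Y \<in> Ob D" "\<sigma> Q \<in> Ob D"
    using N Q wf by (auto simp: zero_object_in_Ob shift_in_Ob)
  note pS = shiftM_in_Hom[OF Q wf(2) p(1)] and fS = shiftM_in_Hom[OF wf(1,2,4)]
  have tN: "(Q, N, \<sigma> Q, Zero D Q N, Zero D N (\<sigma> Q), neg (\<sigma> Q) (\<sigma> Q) (ShiftM D (Ident D Q))) \<in> Tri D"
    using tri_rotate[of Q Q N] tri_ident[OF Q N] Ob Q by (simp add: zero_in_Hom ident_in_Hom)
  have tR: "(Y, Z, \<sigma> X, g, h, neg (\<sigma> X) (\<sigma> Y) (ShiftM D f)) \<in> Tri D"
    using tri_rotate t wf by blast
  \<comment> \<open>Dually, p extends to a morphism from Q -> N -> Sigma Q to the rotated triangle Y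
    -> Z -> Sigma X. Its third component lives one shift too high and is then pulled back along
    \<open>ShiftM\<close>.\<close>
  have "Zero D N Z \<cdot> Zero D Q N = g \<cdot> p"
    using p wf Ob Q comp_zero zero_in_Hom by metis
  then obtain c where c: "c \<in> Hom D (\<sigma> Q) (\<sigma> X)"
      "ShiftM D p \<cdot> neg (\<sigma> Q) (\<sigma> Q) (ShiftM D (Ident D Q)) = neg (\<sigma> X) (\<sigma> Y) (ShiftM D f) \<cdot> c"
    using tri_morphism[OF tN tR p(1) zero_in_Hom[OF Ob(1) wf(3)]] by blast
  obtain d where d: "d \<in> Hom D Q X" "ShiftM D d = c"
    using shiftM_surj[OF Q wf(1) c(1)] by blast
  \<comment> \<open>Both rotated triangles carry a minus sign on their last map, so the signs
    cancel.\<close>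
  have "neg (\<sigma> Q) (\<sigma> Y) (ShiftM D p) = ShiftM D p \<cdot> neg (\<sigma> Q) (\<sigma> Q) (ShiftM D (Ident D Q))"
    by (simp only: shift_ident[OF Q] comp_neg[OF Ob(4,4,3) ident_in_Hom[OF Ob(4)] pS] comp_ident[OF Ob(4,3) pS])
  also have "\<dots> = neg (\<sigma> Q) (\<sigma> Y) (ShiftM D f \<cdot> c)"
    by (simp only: c(2) neg_comp[OF Ob(4,2,3) c(1) fS])
  finally have "ShiftM D p = ShiftM D f \<cdot> c"
    using neg_neg[OF Ob(4,3) pS] neg_neg[OF Ob(4,3) comp_in_Hom[OF Ob(4,2,3) c(1) fS]] by metis
  then have "f \<cdot> d = p"
    using shiftM_inj[OF Q wf(2) comp_in_Hom[OF Q wf(1,2) d(1) wf(4)] p(1)]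
      shift_comp[OF Q wf(1,2) d(1) wf(4)] d(2) by simp
  then show ?thesis using that d by blast
qed

text \<open>Exactness of Hom(-, Y): p is zero on A, so it factors through B, from which only the
  zero map leads to Y.\<close>

lemma null_hom_dtri_left:
  assumes "dtri D A C B" "Y \<in> Ob D" "null_hom D A Y" "null_hom D B Y"
  shows "null_hom D C Y"
proof -
  obtain f g h where t: "(A, C, B, f, g, h) \<in> Tri D" using assms(1) by (auto simp: dtri_def)
  have wf: "A \<in> Ob D" "C \<in> Ob D" "B \<in> Ob D" "f \<in> Hom D A C" "g \<in> Hom D C B"
    using tri_wf[OF t] by auto
  have "p = Zero D C Y" if p: "p \<in> Hom D C Y" for p
  proof -
    have "p \<cdot> f \<in> Hom D A Y" using p wf assms(2) comp_in_Hom by metis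
    then have "p \<cdot> f = Zero D A Y" using assms(3) by (simp add: null_hom_def)
    then obtain c where "c \<in> Hom D B Y" "c \<cdot> g = p"
      using tri_weak_cokernel[OF t assms(2) p] by blast
    moreover from this have "c = Zero D B Y" using assms(4) by (simp add: null_hom_def)
    ultimately show ?thesis using zero_comp wf assms(2) by metis
  qed
  then show ?thesis using null_hom_iff wf assms(2) by blast
qed

lemma null_hom_dtri_right:
  assumes "dtri D A C B" "Y \<in> Ob D" "null_hom D Y A" "null_hom D Y B"
  shows "null_hom D Y C"
proof -
  obtain f g h where t: "(A, C, B, f, g, h) \<in> Tri D" using assms(1) by (auto simp: dtri_def)
  have wf: "A \<in> Ob D" "C \<in> Ob D" "B \<in> Ob D" "f \<in> Hom D A C" "g \<in> Hom D C B"
    using tri_wf[OF t] by auto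
  have "p = Zero D Y C" if p: "p \<in> Hom D Y C" for p
  proof -
    have "g \<cdot> p \<in> Hom D Y B" using p wf assms(2) comp_in_Hom by metis
    then have "g \<cdot> p = Zero D Y B" using assms(4) by (simp add: null_hom_def)
    then obtain c where "c \<in> Hom D Y A" "f \<cdot> c = p"
      using tri_weak_kernel[OF t assms(2) p] by blast
    moreover from this have "c = Zero D Y A" using assms(3) by (simp add: null_hom_def)
    ultimately show ?thesis using comp_zero wf assms(2) by metis
  qed
  then show ?thesis using null_hom_iff wf assms(2) by blast
qed

text \<open>This is \<open>null_hom_dtri_left\<close> for the rotated triangle C -> B -> Sigma
  A.\<close>

lemma null_hom_dtri_left3:
  "dtri D A C B \<Longrightarrow> Y \<in> Ob D \<Longrightarrow> null_hom D C Y \<Longrightarrow> null_hom D (\<sigma> A) Y \<Longrightarrow> null_hom D B Y"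
  using null_hom_dtri_left dtri_rotate_iff dtri_wf by metis

text \<open>In the long exact sequence Hom(Y, A) sits between Hom(Y, Sigma^-1 B) and Hom(Y, C).
  Testing B -> Sigma A -> Sigma C with Sigma Y expresses this without an inverse shift.\<close>

lemma null_hom_dtri_right1:
  assumes "dtri D A C B" "Y \<in> Ob D" "null_hom D Y C" "null_hom D (\<sigma> Y) B"
  shows "null_hom D Y A"
proof -
  have wf: "A \<in> Ob D" "C \<in> Ob D" using dtri_wf[OF assms(1)] by auto
  then have "dtri D B (\<sigma> A) (\<sigma> C)" using assms(1) by (simp add: dtri_rotate_iff)
  then have "null_hom D (\<sigma> Y) (\<sigma> A)"
    using null_hom_dtri_right[of B "\<sigma> A" "\<sigma> C" "\<sigma> Y"] assms wf
    by (simp add: shift_in_Ob null_hom_shift_iff)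
  then show ?thesis using null_hom_shift_iff assms(2) wf by blast
qed

text \<open>The two outer maps vanish, so the identity of A factors through the weak cokernel and
  that of C through the weak kernel. These factorisations are a retraction and a section of the
  middle map.\<close>

lemma dtri_zero_isomorphic:
  assumes "dtri D Z A C" "zero_object D Z"
  shows "isomorphic D A C"
proof -
  obtain f g h where t: "(Z, A, C, f, g, h) \<in> Tri D" using assms(1) by (auto simp: dtri_def)
  have wf: "A \<in> Ob D" "C \<in> Ob D" "Z \<in> Ob D" "f \<in> Hom D Z A" "g \<in> Hom D A C" "h \<in> Hom D C (\<sigma> Z)"
    using tri_wf[OF t] by auto
  have "f = Zero D Z A" using null_hom_from_zero assms(2) wf unfolding null_hom_def by blast
  then have "Ident D A \<cdot> f = Zero D Z A" using wf ident_comp by metis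
  then obtain r where r: "r \<in> Hom D C A" "r \<cdot> g = Ident D A"
    using tri_weak_cokernel[OF t wf(1) ident_in_Hom[OF wf(1)]] by blast
  have tR: "(A, C, \<sigma> Z, g, h, neg (\<sigma> Z) (\<sigma> A) (ShiftM D f)) \<in> Tri D"
    using tri_rotate t wf by blast
  have "h = Zero D C (\<sigma> Z)"
    using null_hom_to_zero[OF zero_object_shift[OF assms(2)]] wf unfolding null_hom_def by blast
  then have "h \<cdot> Ident D C = Zero D C (\<sigma> Z)" using wf comp_ident shift_in_Ob by metis
  then obtain s where "s \<in> Hom D C A" "g \<cdot> s = Ident D C"
    using tri_weak_kernel[OF tR wf(2) ident_in_Hom[OF wf(2)]] by blast
  then show ?thesis using isomorphic_if_split r wf by blast
qed

text \<open>Hom(B, B) is squeezed between Hom(Sigma A, B) and Hom(C, B), so B is zero. The vanishing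
  of Hom(Sigma A, B) is what the second orthogonality condition of an s-torsion pair
  provides.\<close>

lemma dtri_isomorphic_left:
  assumes "dtri D A C B" "null_hom D C B" "null_hom D (\<sigma> A) B"
  shows "isomorphic D A C"
proof -
  have wf: "A \<in> Ob D" "C \<in> Ob D" "B \<in> Ob D" using dtri_wf[OF assms(1)] by auto
  have "null_hom D B B" using null_hom_dtri_left3 assms wf by blast
  then have "zero_object D B" using wf by (simp add: zero_object_iff)
  moreover have "dtri D B (\<sigma> A) (\<sigma> C)" using assms(1) wf by (simp add: dtri_rotate_iff)
  ultimately show ?thesis using dtri_zero_isomorphic isomorphic_unshift wf by blast
qed

text \<open>Here Hom(A, A) is squeezed between Hom(Sigma A, B) and Hom(A, C), so A is the zero
  term.\<close>

lemma dtri_isomorphic_right: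
  assumes "dtri D A C B" "null_hom D A C" "null_hom D (\<sigma> A) B"
  shows "isomorphic D B C"
proof -
  have wf: "A \<in> Ob D" using dtri_wf[OF assms(1)] by auto
  have "null_hom D A A" using null_hom_dtri_right1 assms wf by blast
  then have "zero_object D A" using wf by (simp add: zero_object_iff)
  then show ?thesis using dtri_zero_isomorphic isomorphic_sym assms(1) by metis
qed

section \<open>The star product of classes\<close>

lemma replete_star: "\<A> \<subseteq> Ob D \<Longrightarrow> \<B> \<subseteq> Ob D \<Longrightarrow> replete D (\<A> \<star> \<B>)"
  unfolding iso_closed_in_def
  by (auto simp: mem_star_iff) (meson dtri_isomorphic dtri_wf isomorphic_refl)

text \<open>Both inclusions regroup a two-step filtration of M by the octahedral axiom.\<close>

lemma star_assoc:
  assumes "\<A> \<subseteq> Ob D" "\<B> \<subseteq> Ob D"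
  shows "\<A> \<star> \<B> \<star> \<E> = \<A> \<star> (\<B> \<star> \<E>)"
proof
  show "\<A> \<star> \<B> \<star> \<E> \<subseteq> \<A> \<star> (\<B> \<star> \<E>)"
  proof
    fix M assume "M \<in> \<A> \<star> \<B> \<star> \<E>"
    then obtain N A B E where M: "M \<in> Ob D" "dtri D N M E" "dtri D A N B"
        "A \<in> \<A>" "B \<in> \<B>" "E \<in> \<E>"
      by (metis starE)
    obtain Y where "dtri D A M Y" "dtri D B Y E"
      using dtri_octahedral[OF M(3,2)] by blast
    then show "M \<in> \<A> \<star> (\<B> \<star> \<E>)"
      unfolding mem_star_iff[of M] using M dtri_wf mem_star_iff by metis
  qed
  show "\<A> \<star> (\<B> \<star> \<E>) \<subseteq> \<A> \<star> \<B> \<star> \<E>"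
  proof
    fix M assume "M \<in> \<A> \<star> (\<B> \<star> \<E>)"
    then obtain N A B E where M: "M \<in> Ob D" "dtri D A M N" "dtri D B N E"
        "A \<in> \<A>" "B \<in> \<B>" "E \<in> \<E>"
      by (metis starE)
    then have Ob: "A \<in> Ob D" "B \<in> Ob D" using assms by auto
    \<comment> \<open>The octahedron needs composable maps, so the triangles are rotated to start
      with M -> N and N -> E. The cone Y of M -> E is an extension of Sigma B by Sigma A, and its
      inverse shift P is the extension of B by A that is sought.\<close>
    then have "dtri D M N (\<sigma> A)" "dtri D N E (\<sigma> B)"
      using M by (simp_all add: dtri_rotate_iff)
    then obtain Y where Y: "dtri D M E Y" "dtri D (\<sigma> A) Y (\<sigma> B)"
      using dtri_octahedral by blast
    define P where "P = \<tau> Y"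
    have P: "P \<in> Ob D" "\<sigma> P = Y"
      using dtri_wf[OF Y(1)] by (simp_all add: P_def unshift_in_Ob shift_unshift)
    have "dtri D P M E" using Y(1) P dtri_rotate_iff[of P] by simp
    moreover have "dtri D A P B" using Y(2) P Ob dtri_shift_iff[of A B P] by simp
    ultimately show "M \<in> \<A> \<star> \<B> \<star> \<E>"
      unfolding mem_star_iff[of M] using M P mem_star_iff by metis
  qed
qed

lemma subset_star_left:
  "\<A> \<subseteq> Ob D \<Longrightarrow> Z \<in> \<B> \<Longrightarrow> zero_object D Z \<Longrightarrow> \<A> \<subseteq> \<A> \<star> \<B>"
  unfolding mem_star_iff subset_iff using dtri_self_zero by blast

lemma subset_star_right:
  "\<B> \<subseteq> Ob D \<Longrightarrow> Z \<in> \<A> \<Longrightarrow> zero_object D Z \<Longrightarrow> \<B> \<subseteq> \<A> \<star> \<B>"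
  unfolding mem_star_iff subset_iff using dtri_zero_self by blast

end

section \<open>Intervals of s-torsion pairs\<close>

text \<open>Standing assumption on the ambient class: isomorphism-closure relative to it agrees with
  repleteness in the whole category, and all zero objects lie in it.\<close>

definition ext_class :: "('o, 'm, 'z) pretriangulated_scheme \<Rightarrow> 'o set \<Rightarrow> bool"
  where "ext_class D \<X> \<longleftrightarrow> extension_closed D \<X> \<and> replete D \<X> \<and> (\<exists>Z\<in>\<X>. zero_object D Z)"

lemma hom_vanishesD: "hom_vanishes D \<A> \<B> \<Longrightarrow> A \<in> \<A> \<Longrightarrow> B \<in> \<B> \<Longrightarrow> null_hom D A B"
  by (simp add: hom_vanishes_iff)

lemma hom_vanishes_mono:
  "hom_vanishes D \<A> \<B> \<Longrightarrow> \<A>' \<subseteq> \<A> \<Longrightarrow> \<B>' \<subseteq> \<B> \<Longrightarrow> hom_vanishes D \<A>' \<B>'"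
  by (auto simp: hom_vanishes_iff)

text \<open>Inclusion of first components is only a preorder on pairs; it is antisymmetric exactly
  when the first component determines the pair.\<close>

lemma partial_order_on_fst_order:
  assumes "inj_on fst R"
  shows "partial_order_on R (fst_order R)"
proof -
  have "antisym (fst_order R)"
    by (rule antisymI) (use assms in \<open>auto simp: fst_order_def dest: inj_onD\<close>)
  moreover have "refl_on R (fst_order R)" "trans (fst_order R)" "fst_order R \<subseteq> R \<times> R"
    unfolding refl_on_def trans_def fst_order_def by auto
  ultimately show ?thesis
    unfolding partial_order_on_def preorder_on_def by simp
qed

lemma poset_isoI:
  assumes "inj_on fst P" "inj_on fst Q" "f \<in> P \<rightarrow> Q" "g \<in> Q \<rightarrow> P"
    and "\<And>p. p \<in> P \<Longrightarrow> g (f p) = p" "\<And>q. q \<in> Q \<Longrightarrow> f (g q) = q"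
    and "\<And>p p'. p \<in> P \<Longrightarrow> p' \<in> P \<Longrightarrow> fst p \<subseteq> fst p' \<Longrightarrow> fst (f p) \<subseteq> fst (f p')"
    and "\<And>q q'. q \<in> Q \<Longrightarrow> q' \<in> Q \<Longrightarrow> fst q \<subseteq> fst q' \<Longrightarrow> fst (g q) \<subseteq> fst (g q')"
  shows "pairs_iso P Q f"
proof -
  have "bij_betw f P Q"
    using assms(3-6) by (intro bij_betw_byWitness[where f' = g]) auto
  moreover have "(p, p') \<in> fst_order P \<longleftrightarrow> (f p, f p') \<in> fst_order Q" if "p \<in> P" "p' \<in> P" for p p'
  proof -
    have Q: "f p \<in> Q" "f p' \<in> Q" using that assms(3) by auto
    have "fst p \<subseteq> fst p' \<longleftrightarrow> fst (f p) \<subseteq> fst (f p')"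
      using assms(7)[OF that] assms(8)[OF Q] assms(5)[OF that(1)] assms(5)[OF that(2)] by auto
    then show ?thesis using that Q by (simp add: fst_order_def)
  qed
  ultimately show ?thesis
    using partial_order_on_fst_order[OF assms(1)] partial_order_on_fst_order[OF assms(2)] by (simp add: poset_iso_def)
qed

lemma poset_iso_comp:
  assumes "poset_iso A r B s f" "poset_iso B s C t g" "\<And>x. x \<in> A \<Longrightarrow> h x = g (f x)"
  shows "poset_iso A r C t h"
proof -
  have "bij_betw (g \<circ> f) A C"
    using assms(1,2) bij_betw_trans unfolding poset_iso_def by blast
  then have "bij_betw h A C"
    using assms(3) by (simp cong: bij_betw_cong)
  then show ?thesis
    using assms unfolding poset_iso_def by (auto dest: bij_betwE)
qed

section \<open>Shifts of classes and vanishing of Hom\<close>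

context triangulated_category
begin

lemma shift_class_subset_Ob: "\<A> \<subseteq> Ob D \<Longrightarrow> shift_class D \<A> \<subseteq> Ob D"
  by (auto simp: shift_class_def shift_in_Ob)

lemma unshift_class_subset_Ob: "\<A> \<subseteq> Ob D \<Longrightarrow> unshift_class D \<A> \<subseteq> Ob D"
  by (auto simp: unshift_class_def unshift_in_Ob)

lemma shift_unshift_class: "\<A> \<subseteq> Ob D \<Longrightarrow> shift_class D (unshift_class D \<A>) = \<A>"
  by (force simp: shift_class_def unshift_class_def shift_unshift)

lemma unshift_shift_class: "\<A> \<subseteq> Ob D \<Longrightarrow> unshift_class D (shift_class D \<A>) = \<A>"
  by (force simp: shift_class_def unshift_class_def unshift_shift)

lemma shift_class_mono: "\<A> \<subseteq> \<B> \<Longrightarrow> shift_class D \<A> \<subseteq> shift_class D \<B>"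
  by (auto simp: shift_class_def)

lemma unshift_class_mono: "\<A> \<subseteq> \<B> \<Longrightarrow> unshift_class D \<A> \<subseteq> unshift_class D \<B>"
  by (auto simp: unshift_class_def)

lemma shift_class_Ob: "shift_class D (Ob D) = Ob D"
  using shift_bij by (simp add: shift_class_def bij_betw_def)

lemma unshift_class_Ob: "unshift_class D (Ob D) = Ob D"
  using unshift_shift_class[of "Ob D"] by (simp add: shift_class_Ob)

lemma mem_unshift_class_iff: "\<A> \<subseteq> Ob D \<Longrightarrow> X \<in> Ob D \<Longrightarrow> X \<in> unshift_class D \<A> \<longleftrightarrow> \<sigma> X \<in> \<A>"
  using unshift_shift[of X] shift_unshift by (force simp: unshift_class_def image_iff)

lemma unshift_class_Int:
  assumes "\<A> \<subseteq> Ob D" "\<B> \<subseteq> Ob D"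
  shows "unshift_class D (\<A> \<inter> \<B>) = unshift_class D \<A> \<inter> unshift_class D \<B>"
proof -
  have "inj_on (inv_into (Ob D) (Shift D)) (Ob D)"
    using shift_bij by (simp add: bij_betw_def inj_on_inv_into)
  then show ?thesis
    unfolding unshift_class_def using assms by (rule inj_on_image_Int)
qed

lemma star_subset_Ob: "\<A> \<star> \<B> \<subseteq> Ob D"
  by (auto simp: star_def)

lemma replete_unshift_class:
  assumes "replete D \<A>"
  shows "replete D (unshift_class D \<A>)"
proof -
  note sub = replete_subset[OF assms]
  have "Y \<in> unshift_class D \<A>" if "X \<in> unshift_class D \<A>" "Y \<in> Ob D" "isomorphic D X Y" for X Y
  proof -
    have X: "X \<in> Ob D" using that(1) unshift_class_subset_Ob[OF sub] by blast
    then have "\<sigma> X \<in> \<A>" using that(1) mem_unshift_class_iff[OF sub] by blast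
    then have "\<sigma> Y \<in> \<A>"
      using repleteD[OF assms _ isomorphic_shift[OF X that(2,3)] shift_in_Ob[OF that(2)]] by blast
    then show ?thesis using mem_unshift_class_iff[OF sub that(2)] by blast
  qed
  then show ?thesis
    using unshift_class_subset_Ob[OF sub] by (auto simp: iso_closed_in_def)
qed

lemma replete_shift_class:
  assumes "replete D \<A>"
  shows "replete D (shift_class D \<A>)"
proof -
  note sub = replete_subset[OF assms]
  have "Y \<in> shift_class D \<A>" if "X \<in> \<A>" "Y \<in> Ob D" "isomorphic D (\<sigma> X) Y" for X Y
  proof -
    have "isomorphic D (\<sigma> X) (\<sigma> (\<tau> Y))" using that by (simp add: shift_unshift)
    then have "isomorphic D X (\<tau> Y)"
      using isomorphic_unshift[OF subsetD[OF sub that(1)] unshift_in_Ob[OF that(2)]] by blast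
    then have "\<tau> Y \<in> \<A>" using repleteD[OF assms that(1)] unshift_in_Ob[OF that(2)] by blast
    then show ?thesis using shift_unshift[OF that(2)] by (metis image_eqI shift_class_def)
  qed
  then show ?thesis
    using shift_class_subset_Ob[OF sub] by (auto simp: iso_closed_in_def shift_class_def)
qed

lemma shift_class_star:
  assumes "\<A> \<subseteq> Ob D" "\<B> \<subseteq> Ob D"
  shows "shift_class D (\<A> \<star> \<B>) = shift_class D \<A> \<star> shift_class D \<B>"
proof
  show "shift_class D (\<A> \<star> \<B>) \<subseteq> shift_class D \<A> \<star> shift_class D \<B>"
  proof
    fix Y assume "Y \<in> shift_class D (\<A> \<star> \<B>)"
    then obtain C where C: "C \<in> \<A> \<star> \<B>" "Y = \<sigma> C" by (auto simp: shift_class_def)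
    obtain A B where AB: "A \<in> \<A>" "B \<in> \<B>" "C \<in> Ob D" "dtri D A C B"
      using C(1) by (rule starE)
    then have "dtri D (\<sigma> A) (\<sigma> C) (\<sigma> B)" using assms dtri_shift_iff[of A B C] by blast
    then show "Y \<in> shift_class D \<A> \<star> shift_class D \<B>"
      using AB C(2) shift_in_Ob by (auto simp: mem_star_iff shift_class_def)
  qed
next
  show "shift_class D \<A> \<star> shift_class D \<B> \<subseteq> shift_class D (\<A> \<star> \<B>)"
  proof
    fix Y assume "Y \<in> shift_class D \<A> \<star> shift_class D \<B>"
    then obtain A B where AB: "A \<in> \<A>" "B \<in> \<B>" "Y \<in> Ob D" "dtri D (\<sigma> A) Y (\<sigma> B)"
      by (auto simp: mem_star_iff shift_class_def)
    then have "dtri D A (\<tau> Y) B"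
      using assms dtri_shift_iff[of A B "\<tau> Y"] by (auto simp: unshift_in_Ob shift_unshift)
    then have "\<tau> Y \<in> \<A> \<star> \<B>" using AB unshift_in_Ob by (auto simp: mem_star_iff)
    then show "Y \<in> shift_class D (\<A> \<star> \<B>)"
      using shift_unshift[OF AB(3)] by (metis image_eqI shift_class_def)
  qed
qed

lemma unshift_class_star:
  assumes "\<A> \<subseteq> Ob D" "\<B> \<subseteq> Ob D"
  shows "unshift_class D (\<A> \<star> \<B>) = unshift_class D \<A> \<star> unshift_class D \<B>"
  using shift_class_star[OF assms[THEN unshift_class_subset_Ob]] assms
    unshift_shift_class[OF star_subset_Ob, of "unshift_class D \<A>" "unshift_class D \<B>"]
  by (simp add: shift_unshift_class)

lemma hom_vanishes_shift_iff:
  "\<A> \<subseteq> Ob D \<Longrightarrow> \<B> \<subseteq> Ob D \<Longrightarrow>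
    hom_vanishes D (shift_class D \<A>) (shift_class D \<B>) \<longleftrightarrow> hom_vanishes D \<A> \<B>"
  using null_hom_shift_iff by (simp add: hom_vanishes_iff shift_class_def subset_iff)

lemma hom_vanishes_unshift_iff:
  "\<A> \<subseteq> Ob D \<Longrightarrow> \<B> \<subseteq> Ob D \<Longrightarrow>
    hom_vanishes D (unshift_class D \<A>) (unshift_class D \<B>) \<longleftrightarrow> hom_vanishes D \<A> \<B>"
  using hom_vanishes_shift_iff[of "unshift_class D \<A>" "unshift_class D \<B>"]
  by (simp add: unshift_class_subset_Ob shift_unshift_class)

text \<open>Trades the inverse shift in the second orthogonality condition for a shift on the left,
  where it matches the term Sigma A of a rotated triangle.\<close>

lemma hom_vanishes_unshift_right_iff:
  "\<A> \<subseteq> Ob D \<Longrightarrow> \<B> \<subseteq> Ob D \<Longrightarrow>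
    hom_vanishes D \<A> (unshift_class D \<B>) \<longleftrightarrow> hom_vanishes D (shift_class D \<A>) \<B>"
  using hom_vanishes_shift_iff[of \<A> "unshift_class D \<B>"]
  by (simp add: unshift_class_subset_Ob shift_unshift_class)

lemma hom_vanishes_star_left:
  assumes "\<B> \<subseteq> Ob D" "hom_vanishes D \<A> \<B>" "hom_vanishes D \<A>' \<B>"
  shows "hom_vanishes D (\<A> \<star> \<A>') \<B>"
  unfolding hom_vanishes_iff
proof (intro ballI)
  fix C Y assume C: "C \<in> \<A> \<star> \<A>'" and Y: "Y \<in> \<B>"
  from C obtain A A' where "A \<in> \<A>" "A' \<in> \<A>'" "C \<in> Ob D" "dtri D A C A'" by (rule starE)
  then show "null_hom D C Y"
    using null_hom_dtri_left hom_vanishesD[OF assms(2)] hom_vanishesD[OF assms(3)] assms(1) Y by blast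
qed

lemma hom_vanishes_star_right:
  assumes "\<A> \<subseteq> Ob D" "hom_vanishes D \<A> \<B>" "hom_vanishes D \<A> \<B>'"
  shows "hom_vanishes D \<A> (\<B> \<star> \<B>')"
  unfolding hom_vanishes_iff
proof (intro ballI)
  fix C Y assume Y: "Y \<in> \<A>" and C: "C \<in> \<B> \<star> \<B>'"
  from C obtain B B' where "B \<in> \<B>" "B' \<in> \<B>'" "C \<in> Ob D" "dtri D B C B'" by (rule starE)
  then show "null_hom D Y C"
    using null_hom_dtri_right hom_vanishesD[OF assms(2)] hom_vanishesD[OF assms(3)] assms(1) Y by blast
qed

section \<open>Closure properties of the ambient classes\<close>

lemma ext_class_zero: "ext_class D \<A> \<Longrightarrow> zero_object D Z \<Longrightarrow> Z \<in> \<A>"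
  unfolding ext_class_def using replete_zero_object by blast

lemma ext_class_star: "ext_class D \<X> \<Longrightarrow> \<A> \<subseteq> \<X> \<Longrightarrow> \<B> \<subseteq> \<X> \<Longrightarrow> \<A> \<star> \<B> \<subseteq> \<X>"
  unfolding ext_class_def extension_closed_def using star_mono[of \<A> \<X> \<B> \<X> D] by blast

lemma ext_class_Int:
  assumes "ext_class D \<A>" "ext_class D \<B>"
  shows "ext_class D (\<A> \<inter> \<B>)"
proof -
  obtain Z where Z: "zero_object D Z" using zero_object_exists by blast
  have "replete D (\<A> \<inter> \<B>)" using assms by (simp add: ext_class_def replete_Int)
  moreover have "(\<A> \<inter> \<B>) \<star> (\<A> \<inter> \<B>) \<subseteq> \<A> \<inter> \<B>"
    using ext_class_star[OF assms(1)] ext_class_star[OF assms(2)] by (meson Int_greatest Int_lower1 Int_lower2)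
  ultimately show ?thesis
    using Z ext_class_zero[OF assms(1) Z] ext_class_zero[OF assms(2) Z] replete_subset[of D "\<A> \<inter> \<B>"]
    by (auto simp: ext_class_def extension_closed_def)
qed

lemma ext_class_replete: "ext_class D \<X> \<Longrightarrow> replete D \<X>"
  by (simp add: ext_class_def)

lemma ext_class_Ob: "ext_class D (Ob D)"
  using zero_object_exists star_subset_Ob
  by (auto simp: ext_class_def extension_closed_def iso_closed_in_def intro: zero_object_in_Ob)

lemma ext_class_unshift: "ext_class D \<X> \<Longrightarrow> ext_class D (unshift_class D \<X>)"
  unfolding ext_class_def extension_closed_def
proof (elim conjE, intro conjI)
  assume X: "\<X> \<subseteq> Ob D" "\<X> \<star> \<X> \<subseteq> \<X>" "replete D \<X>" and zero: "\<exists>Z\<in>\<X>. zero_object D Z"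
  show "unshift_class D \<X> \<subseteq> Ob D" using X(1) by (rule unshift_class_subset_Ob)
  show "unshift_class D \<X> \<star> unshift_class D \<X> \<subseteq> unshift_class D \<X>"
    using unshift_class_star[OF X(1,1)] unshift_class_mono[OF X(2)] by simp
  show "replete D (unshift_class D \<X>)" using X(3) by (rule replete_unshift_class)
  obtain Z where Z: "zero_object D Z" "Z \<in> \<X>" using zero by blast
  then have "\<sigma> Z \<in> \<X>"
    using replete_zero_object[OF X(3) Z(2,1) zero_object_shift[OF Z(1)]] by blast
  then have "Z \<in> unshift_class D \<X>"
    using mem_unshift_class_iff[OF X(1)] zero_object_in_Ob[OF Z(1)] by blast
  then show "\<exists>Z\<in>unshift_class D \<X>. zero_object D Z" using Z(1) by blast
qed

lemma ext_class_shift: "ext_class D \<X> \<Longrightarrow> ext_class D (shift_class D \<X>)"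
  unfolding ext_class_def extension_closed_def
proof (elim conjE, intro conjI)
  assume X: "\<X> \<subseteq> Ob D" "\<X> \<star> \<X> \<subseteq> \<X>" "replete D \<X>" and zero: "\<exists>Z\<in>\<X>. zero_object D Z"
  show "shift_class D \<X> \<subseteq> Ob D" using X(1) by (rule shift_class_subset_Ob)
  show "shift_class D \<X> \<star> shift_class D \<X> \<subseteq> shift_class D \<X>"
    using shift_class_star[OF X(1,1)] shift_class_mono[OF X(2)] by simp
  show "replete D (shift_class D \<X>)" using X(3) by (rule replete_shift_class)
  show "\<exists>Z\<in>shift_class D \<X>. zero_object D Z"
    using zero zero_object_shift by (auto simp: shift_class_def)
qed

section \<open>s-torsion pairs as pairs of mutually orthogonal classes\<close>

lemma s_torsion_pair_iff:
  assumes X: "ext_class D \<X>"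
  shows "s_torsion_pair D \<X> (\<T>, \<F>) \<longleftrightarrow> \<T> \<subseteq> \<X> \<and> \<F> \<subseteq> \<X> \<and> replete D \<T> \<and> replete D \<F> \<and>
    hom_vanishes D \<T> \<F> \<and> hom_vanishes D (shift_class D \<T>) \<F> \<and> \<X> = \<T> \<star> \<F>"
proof -
  have Ob: "\<X> \<subseteq> Ob D" using X by (simp add: ext_class_def extension_closed_def)
  \<comment> \<open>An object isomorphic to a member of the subclass already lies in the replete
    class \<open>\<X>\<close>, so relative and absolute closure agree.\<close>
  have "iso_closed_in D \<X> \<A> \<longleftrightarrow> replete D \<A>" if "\<A> \<subseteq> \<X>" for \<A>
    using that Ob ext_class_replete[OF X] by (auto simp: iso_closed_in_def)
  moreover have "iso_closed_in D \<X> \<A> \<Longrightarrow> \<A> \<subseteq> \<X>" for \<A>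
    by (simp add: iso_closed_in_def)
  moreover have "hom_vanishes D \<T> (unshift_class D \<F>) \<longleftrightarrow> hom_vanishes D (shift_class D \<T>) \<F>"
    if "\<T> \<subseteq> \<X>" "\<F> \<subseteq> \<X>"
    using that Ob hom_vanishes_unshift_right_iff by auto
  ultimately show ?thesis
    using X unfolding s_torsion_pair_def ext_class_def by auto
qed

lemma s_torsion_pairD:
  assumes "ext_class D \<X>" "s_torsion_pair D \<X> (\<T>, \<F>)"
  shows "\<T> \<subseteq> \<X>" "\<F> \<subseteq> \<X>" "replete D \<T>" "replete D \<F>" "hom_vanishes D \<T> \<F>"
    "hom_vanishes D (shift_class D \<T>) \<F>" "\<X> = \<T> \<star> \<F>" "\<T> \<subseteq> Ob D" "\<F> \<subseteq> Ob D"
  by (insert assms(2)[unfolded s_torsion_pair_iff[OF assms(1)]])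
    (elim conjE, (assumption | erule replete_subset))+

lemma s_torsion_pair_null_hom:
  assumes "ext_class D \<X>" "s_torsion_pair D \<X> (\<T>, \<F>)" "A \<in> \<T>" "B \<in> \<F>"
  shows "null_hom D A B" "null_hom D (\<sigma> A) B"
  using s_torsion_pairD(5,6)[OF assms(1,2)] assms(3,4) by (auto simp: hom_vanishes_iff shift_class_def)

lemma s_torsion_pair_triangle:
  assumes "ext_class D \<X>" "s_torsion_pair D \<X> (\<T>, \<F>)" "C \<in> \<X>"
  obtains A B where "A \<in> \<T>" "B \<in> \<F>" "C \<in> Ob D" "dtri D A C B"
  using s_torsion_pairD(7)[OF assms(1,2)] assms(3) that starE[of C D \<T> \<F>] by blast

text \<open>In the torsion triangle A -> X -> B neither X nor Sigma A maps nontrivially to B. Hence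
  B is zero and X is isomorphic to A.\<close>

lemma s_torsion_pair_left_iff:
  assumes X: "ext_class D \<X>" and p: "s_torsion_pair D \<X> (\<T>, \<F>)"
  shows "X \<in> \<T> \<longleftrightarrow> X \<in> \<X> \<and> (\<forall>Y\<in>\<F>. null_hom D X Y)"
proof
  note d = s_torsion_pairD[OF X p]
  show "X \<in> \<T> \<Longrightarrow> X \<in> \<X> \<and> (\<forall>Y\<in>\<F>. null_hom D X Y)"
    using d(1,5) by (auto simp: hom_vanishes_iff)
  assume a: "X \<in> \<X> \<and> (\<forall>Y\<in>\<F>. null_hom D X Y)"
  then obtain A B where AB: "A \<in> \<T>" "B \<in> \<F>" "X \<in> Ob D" "dtri D A X B"
    using s_torsion_pair_triangle[OF X p] by blast
  have "null_hom D (\<sigma> A) B" using s_torsion_pair_null_hom(2)[OF X p AB(1,2)] .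
  then have "isomorphic D A X" using dtri_isomorphic_left[OF AB(4)] AB(2) a by blast
  then show "X \<in> \<T>" using repleteD[OF d(3) AB(1) _ AB(3)] by blast
qed

text \<open>In the triangle A -> Y -> B the maps from A to Y and from Sigma A to B vanish, which
  forces A to be zero.\<close>

lemma s_torsion_pair_right_iff:
  assumes X: "ext_class D \<X>" and p: "s_torsion_pair D \<X> (\<T>, \<F>)"
  shows "Y \<in> \<F> \<longleftrightarrow> Y \<in> \<X> \<and> (\<forall>X\<in>\<T>. null_hom D X Y)"
proof
  note d = s_torsion_pairD[OF X p]
  show "Y \<in> \<F> \<Longrightarrow> Y \<in> \<X> \<and> (\<forall>X\<in>\<T>. null_hom D X Y)"
    using d(2,5) by (auto simp: hom_vanishes_iff)
  assume a: "Y \<in> \<X> \<and> (\<forall>X\<in>\<T>. null_hom D X Y)"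
  then obtain A B where AB: "A \<in> \<T>" "B \<in> \<F>" "Y \<in> Ob D" "dtri D A Y B"
    using s_torsion_pair_triangle[OF X p] by blast
  have "null_hom D (\<sigma> A) B" using s_torsion_pair_null_hom(2)[OF X p AB(1,2)] .
  then have "isomorphic D B Y" using dtri_isomorphic_right[OF AB(4)] AB(1) a by blast
  then show "Y \<in> \<F>" using repleteD[OF d(4) AB(2) _ AB(3)] by blast
qed

text \<open>A left orthogonal contains the zero objects and, by exactness of Hom, is closed under
  extensions.\<close>

lemma s_torsion_pair_ext_class_left:
  assumes X: "ext_class D \<X>" and p: "s_torsion_pair D \<X> (\<T>, \<F>)"
  shows "ext_class D \<T>"
proof -
  note d = s_torsion_pairD[OF X p]
  obtain Z where Z: "zero_object D Z" using zero_object_exists by blast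
  have "Z \<in> \<T>"
    unfolding s_torsion_pair_left_iff[OF X p]
    using ext_class_zero[OF X Z] null_hom_from_zero[OF Z] d(9) by blast
  moreover have "C \<in> \<T>" if "C \<in> \<T> \<star> \<T>" for C
    unfolding s_torsion_pair_left_iff[OF X p]
    using ext_class_star[OF X d(1,1)] hom_vanishesD[OF hom_vanishes_star_left[OF d(9,5,5)]] that
    by blast
  ultimately show ?thesis
    unfolding ext_class_def extension_closed_def using Z d(3,8) by blast
qed

lemma s_torsion_pair_ext_class_right:
  assumes X: "ext_class D \<X>" and p: "s_torsion_pair D \<X> (\<T>, \<F>)"
  shows "ext_class D \<F>"
proof -
  note d = s_torsion_pairD[OF X p]
  obtain Z where Z: "zero_object D Z" using zero_object_exists by blast
  have "Z \<in> \<F>"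
    unfolding s_torsion_pair_right_iff[OF X p]
    using ext_class_zero[OF X Z] null_hom_to_zero[OF Z] d(8) by blast
  moreover have "C \<in> \<F>" if "C \<in> \<F> \<star> \<F>" for C
    unfolding s_torsion_pair_right_iff[OF X p]
    using ext_class_star[OF X d(2,2)] hom_vanishesD[OF hom_vanishes_star_right[OF d(8,5,5)]] that
    by blast
  ultimately show ?thesis
    unfolding ext_class_def extension_closed_def using Z d(4,9) by blast
qed

text \<open>The halves are mutual orthogonals, and passing to orthogonals reverses
  inclusions.\<close>

lemma s_torsion_pair_subset_iff:
  assumes X: "ext_class D \<X>" and p: "s_torsion_pair D \<X> (\<T>, \<F>)" "s_torsion_pair D \<X> (\<T>', \<F>')"
  shows "\<T> \<subseteq> \<T>' \<longleftrightarrow> \<F>' \<subseteq> \<F>"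
  using s_torsion_pair_left_iff[OF X p(1)] s_torsion_pair_left_iff[OF X p(2)]
    s_torsion_pair_right_iff[OF X p(1)] s_torsion_pair_right_iff[OF X p(2)]
  by (meson subset_iff)

lemma inj_on_fst_stors:
  assumes X: "ext_class D \<X>"
  shows "inj_on fst (stors D \<X>)"
proof (rule inj_onI)
  fix p q assume pq: "p \<in> stors D \<X>" "q \<in> stors D \<X>" "fst p = fst q"
  obtain \<T> \<F> \<F>' where e: "p = (\<T>, \<F>)" "q = (\<T>, \<F>')"
    using pq(3) by (metis prod.collapse)
  then show "p = q"
    using pq(1,2) s_torsion_pair_subset_iff[OF X, of \<T> \<F> \<T> \<F>']
      s_torsion_pair_subset_iff[OF X, of \<T> \<F>' \<T> \<F>] by (simp add: stors_def subset_antisym)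
qed

section \<open>Decomposition, restriction and extension along an interval\<close>

lemma s_torsion_pair_interval_left:
  assumes X: "ext_class D \<X>" and p: "s_torsion_pair D \<X> (\<T>\<^sub>1, \<F>\<^sub>1)" "s_torsion_pair D \<X> (\<T>\<^sub>2, \<F>\<^sub>2)"
    and le: "\<T>\<^sub>1 \<subseteq> \<T>\<^sub>2"
  shows "\<T>\<^sub>2 = \<T>\<^sub>1 \<star> (\<T>\<^sub>2 \<inter> \<F>\<^sub>1)"
proof
  note d1 = s_torsion_pairD[OF X p(1)] and d2 = s_torsion_pairD[OF X p(2)]
  show "\<T>\<^sub>1 \<star> (\<T>\<^sub>2 \<inter> \<F>\<^sub>1) \<subseteq> \<T>\<^sub>2"
    using ext_class_star[OF s_torsion_pair_ext_class_left[OF X p(2)] le] by simp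
  show "\<T>\<^sub>2 \<subseteq> \<T>\<^sub>1 \<star> (\<T>\<^sub>2 \<inter> \<F>\<^sub>1)"
  proof
    fix C assume C: "C \<in> \<T>\<^sub>2"
    then obtain A B where AB: "A \<in> \<T>\<^sub>1" "B \<in> \<F>\<^sub>1" "C \<in> Ob D" "dtri D A C B"
      using s_torsion_pair_triangle[OF X p(1)] d2(1) by blast
    \<comment> \<open>Maps from B are controlled by maps from C and from Sigma A. Both kinds vanish
      because C and A lie in \<open>\<T>\<^sub>2\<close>.\<close>
    have "null_hom D B Y" if Y: "Y \<in> \<F>\<^sub>2" for Y
      using null_hom_dtri_left3[OF AB(4)] Y d2(9) s_torsion_pair_null_hom(1)[OF X p(2) C Y]
        s_torsion_pair_null_hom(2)[OF X p(2) subsetD[OF le AB(1)] Y] by blast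
    then have "B \<in> \<T>\<^sub>2" using s_torsion_pair_left_iff[OF X p(2)] AB(2) d1(2) by blast
    then show "C \<in> \<T>\<^sub>1 \<star> (\<T>\<^sub>2 \<inter> \<F>\<^sub>1)" using AB by (auto simp: mem_star_iff)
  qed
qed

text \<open>For Y in \<open>\<T>\<^sub>1\<close>, maps Y -> A are controlled by maps Y -> C, zero
  since C is in \<open>\<F>\<^sub>1\<close>, and by maps Sigma Y -> B, zero since Y is also in
  \<open>\<T>\<^sub>2\<close>. The right-hand decomposition and the restriction both rest on
  this.\<close>

lemma s_torsion_pair_left_term:
  assumes X: "ext_class D \<X>" and p: "s_torsion_pair D \<X> (\<T>\<^sub>1, \<F>\<^sub>1)" "s_torsion_pair D \<X> (\<T>\<^sub>2, \<F>\<^sub>2)"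
    and le: "\<T>\<^sub>1 \<subseteq> \<T>\<^sub>2" and t: "dtri D A C B" "A \<in> \<T>\<^sub>2" "C \<in> \<F>\<^sub>1" "B \<in> \<F>\<^sub>2"
  shows "A \<in> \<F>\<^sub>1"
proof -
  have "null_hom D Y A" if Y: "Y \<in> \<T>\<^sub>1" for Y
    using null_hom_dtri_right1[OF t(1)] Y s_torsion_pairD(8)[OF X p(1)]
      s_torsion_pair_null_hom(1)[OF X p(1) Y t(3)]
      s_torsion_pair_null_hom(2)[OF X p(2) subsetD[OF le Y] t(4)] by blast
  then show ?thesis
    using s_torsion_pair_right_iff[OF X p(1)] t(2) s_torsion_pairD(1)[OF X p(2)] by blast
qed

lemma s_torsion_pair_interval_right:
  assumes X: "ext_class D \<X>" and p: "s_torsion_pair D \<X> (\<T>\<^sub>1, \<F>\<^sub>1)" "s_torsion_pair D \<X> (\<T>\<^sub>2, \<F>\<^sub>2)"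
    and le: "\<T>\<^sub>1 \<subseteq> \<T>\<^sub>2"
  shows "\<F>\<^sub>1 = (\<T>\<^sub>2 \<inter> \<F>\<^sub>1) \<star> \<F>\<^sub>2"
proof
  have "\<F>\<^sub>2 \<subseteq> \<F>\<^sub>1" using le s_torsion_pair_subset_iff[OF X p] by simp
  then show "(\<T>\<^sub>2 \<inter> \<F>\<^sub>1) \<star> \<F>\<^sub>2 \<subseteq> \<F>\<^sub>1"
    using ext_class_star[OF s_torsion_pair_ext_class_right[OF X p(1)]] by simp
  show "\<F>\<^sub>1 \<subseteq> (\<T>\<^sub>2 \<inter> \<F>\<^sub>1) \<star> \<F>\<^sub>2"
  proof
    fix C assume C: "C \<in> \<F>\<^sub>1"
    then obtain A B where AB: "A \<in> \<T>\<^sub>2" "B \<in> \<F>\<^sub>2" "C \<in> Ob D" "dtri D A C B"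
      using s_torsion_pair_triangle[OF X p(2)] s_torsion_pairD(2)[OF X p(1)] by blast
    then have "A \<in> \<F>\<^sub>1" using s_torsion_pair_left_term[OF X p le AB(4,1) C AB(2)] by blast
    then show "C \<in> (\<T>\<^sub>2 \<inter> \<F>\<^sub>1) \<star> \<F>\<^sub>2" using AB by (auto simp: mem_star_iff)
  qed
qed

text \<open>Orthogonality is inherited by subclasses. What remains is that the torsion triangle of
  an object of \<open>\<T>\<^sub>2 \<inter> \<F>\<^sub>1\<close> stays inside: the left
  decomposition puts its third term in \<open>\<T>\<^sub>2\<close>, and
  \<open>s_torsion_pair_left_term\<close> its first term in \<open>\<F>\<^sub>1\<close>.\<close>

lemma s_torsion_pair_restrict:
  assumes X: "ext_class D \<X>" and p: "s_torsion_pair D \<X> (\<T>\<^sub>1, \<F>\<^sub>1)" "s_torsion_pair D \<X> (\<T>\<^sub>2, \<F>\<^sub>2)"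
    and t: "s_torsion_pair D \<X> (\<T>, \<F>)" and le: "\<T>\<^sub>1 \<subseteq> \<T>" "\<T> \<subseteq> \<T>\<^sub>2"
  shows "s_torsion_pair D (\<T>\<^sub>2 \<inter> \<F>\<^sub>1) (\<T> \<inter> \<F>\<^sub>1, \<F> \<inter> \<T>\<^sub>2)"
proof -
  note d1 = s_torsion_pairD[OF X p(1)] and d2 = s_torsion_pairD[OF X p(2)] and d = s_torsion_pairD[OF X t]
  have F: "\<F> \<subseteq> \<F>\<^sub>1" using le s_torsion_pair_subset_iff[OF X p(1) t] by simp
  have K: "ext_class D (\<T>\<^sub>2 \<inter> \<F>\<^sub>1)"
    by (rule ext_class_Int[OF s_torsion_pair_ext_class_left[OF X p(2)]
        s_torsion_pair_ext_class_right[OF X p(1)]])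
  have "\<T>\<^sub>2 \<inter> \<F>\<^sub>1 \<subseteq> (\<T> \<inter> \<F>\<^sub>1) \<star> (\<F> \<inter> \<T>\<^sub>2)"
  proof
    fix C assume C: "C \<in> \<T>\<^sub>2 \<inter> \<F>\<^sub>1"
    then have "C \<in> \<T> \<star> (\<T>\<^sub>2 \<inter> \<F>)" using s_torsion_pair_interval_left[OF X t p(2) le(2)] by simp
    then obtain A B where AB: "A \<in> \<T>" "B \<in> \<T>\<^sub>2 \<inter> \<F>" "C \<in> Ob D" "dtri D A C B" by (rule starE)
    then have "A \<in> \<F>\<^sub>1" using s_torsion_pair_left_term[OF X p(1) t le(1) AB(4,1)] C by simp
    then show "C \<in> (\<T> \<inter> \<F>\<^sub>1) \<star> (\<F> \<inter> \<T>\<^sub>2)" using AB by (auto simp: mem_star_iff)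
  qed
  moreover have "(\<T> \<inter> \<F>\<^sub>1) \<star> (\<F> \<inter> \<T>\<^sub>2) \<subseteq> \<T>\<^sub>2 \<inter> \<F>\<^sub>1"
    using le F by (intro ext_class_star[OF K]) auto
  moreover have "hom_vanishes D (\<T> \<inter> \<F>\<^sub>1) (\<F> \<inter> \<T>\<^sub>2)"
    by (rule hom_vanishes_mono[OF d(5)]) auto
  moreover have "hom_vanishes D (shift_class D (\<T> \<inter> \<F>\<^sub>1)) (\<F> \<inter> \<T>\<^sub>2)"
    by (rule hom_vanishes_mono[OF d(6)]) (auto simp: shift_class_def)
  moreover have "\<T> \<inter> \<F>\<^sub>1 \<subseteq> \<T>\<^sub>2 \<inter> \<F>\<^sub>1" "\<F> \<inter> \<T>\<^sub>2 \<subseteq> \<T>\<^sub>2 \<inter> \<F>\<^sub>1"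
    using le F by auto
  ultimately show ?thesis
    unfolding s_torsion_pair_iff[OF K]
    using replete_Int[OF d(3) d1(4)] replete_Int[OF d(4) d2(3)] subset_antisym by simp
qed

text \<open>Orthogonality passes to star products factor by factor, and associativity regroups a
  fourfold product into the two new halves.\<close>

lemma s_torsion_pair_extend:
  assumes X: "ext_class D \<X>" and p: "s_torsion_pair D \<X> (\<T>\<^sub>1, \<F>\<^sub>1)" "s_torsion_pair D \<X> (\<T>\<^sub>2, \<F>\<^sub>2)"
    and le: "\<T>\<^sub>1 \<subseteq> \<T>\<^sub>2" and t: "s_torsion_pair D (\<T>\<^sub>2 \<inter> \<F>\<^sub>1) (\<A>, \<B>)"
  shows "s_torsion_pair D \<X> (\<T>\<^sub>1 \<star> \<A>, \<B> \<star> \<F>\<^sub>2)" "\<T>\<^sub>1 \<subseteq> \<T>\<^sub>1 \<star> \<A>" "\<T>\<^sub>1 \<star> \<A> \<subseteq> \<T>\<^sub>2"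
    "\<A> \<subseteq> \<T>\<^sub>1 \<star> \<A>" "\<B> \<subseteq> \<B> \<star> \<F>\<^sub>2"
proof -
  note e = s_torsion_pair_ext_class_left[OF X p(1)] s_torsion_pair_ext_class_right[OF X p(1)]
    s_torsion_pair_ext_class_left[OF X p(2)] s_torsion_pair_ext_class_right[OF X p(2)]
  have K: "ext_class D (\<T>\<^sub>2 \<inter> \<F>\<^sub>1)" using e ext_class_Int by blast
  note d1 = s_torsion_pairD[OF X p(1)] and d2 = s_torsion_pairD[OF X p(2)] and k = s_torsion_pairD[OF K t]
  note eK = s_torsion_pair_ext_class_left[OF K t] s_torsion_pair_ext_class_right[OF K t]
  have F: "\<F>\<^sub>2 \<subseteq> \<F>\<^sub>1" using le s_torsion_pair_subset_iff[OF X p] by simp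
  note Ob = d1(8) d2(9) k(8,9)
  have AB: "\<A> \<subseteq> \<T>\<^sub>2" "\<B> \<subseteq> \<F>\<^sub>1" using k(1,2) by auto
  obtain Z where Z: "zero_object D Z" using zero_object_exists by blast
  show "\<T>\<^sub>1 \<subseteq> \<T>\<^sub>1 \<star> \<A>" using subset_star_left[OF Ob(1) ext_class_zero[OF eK(1) Z] Z] .
  show "\<A> \<subseteq> \<T>\<^sub>1 \<star> \<A>" using subset_star_right[OF Ob(3) ext_class_zero[OF e(1) Z] Z] .
  show "\<B> \<subseteq> \<B> \<star> \<F>\<^sub>2" using subset_star_left[OF Ob(4) ext_class_zero[OF e(4) Z] Z] .
  show "\<T>\<^sub>1 \<star> \<A> \<subseteq> \<T>\<^sub>2" using ext_class_star[OF e(3) le AB(1)] .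
  have hv: "hom_vanishes D (\<T> \<star> \<T>') (\<B> \<star> \<F>\<^sub>2)"
    if "\<T> \<subseteq> Ob D" "\<T>' \<subseteq> Ob D" "hom_vanishes D \<T> \<F>\<^sub>1" "hom_vanishes D \<T>' \<B>" "hom_vanishes D \<T>' \<F>\<^sub>2" for \<T> \<T>'
    using that hom_vanishes_mono[OF that(3) subset_refl AB(2)] hom_vanishes_mono[OF that(3) subset_refl F]
    by (simp add: hom_vanishes_star_left hom_vanishes_star_right star_subset_Ob)
  have "hom_vanishes D (\<T>\<^sub>1 \<star> \<A>) (\<B> \<star> \<F>\<^sub>2)"
    by (rule hv[OF Ob(1,3) d1(5) k(5) hom_vanishes_mono[OF d2(5) AB(1) subset_refl]])
  moreover have "hom_vanishes D (shift_class D (\<T>\<^sub>1 \<star> \<A>)) (\<B> \<star> \<F>\<^sub>2)"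
    unfolding shift_class_star[OF Ob(1,3)]
    by (rule hv[OF shift_class_subset_Ob[OF Ob(1)] shift_class_subset_Ob[OF Ob(3)] d1(6) k(6)
        hom_vanishes_mono[OF d2(6) shift_class_mono[OF AB(1)] subset_refl]])
  moreover have "\<X> = (\<T>\<^sub>1 \<star> \<A>) \<star> (\<B> \<star> \<F>\<^sub>2)"
  proof -
    \<comment> \<open>\<open>d1(7)\<close> splits off \<open>\<T>\<^sub>1\<close>, the right-hand
      interval decomposition splits \<open>\<F>\<^sub>1\<close>, and \<open>k(7)\<close> splits the
      class in the middle.\<close>
    have "\<X> = \<T>\<^sub>1 \<star> ((\<A> \<star> \<B>) \<star> \<F>\<^sub>2)"
      using d1(7) k(7) s_torsion_pair_interval_right[OF X p le] by metis
    then show ?thesis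
      by (simp add: star_assoc[OF Ob(3,4)] star_assoc[OF Ob(1,3)])
  qed
  moreover have "\<T>\<^sub>1 \<star> \<A> \<subseteq> \<X>" "\<B> \<star> \<F>\<^sub>2 \<subseteq> \<X>"
    using ext_class_star[OF X d1(1)] ext_class_star[OF X _ d2(2)] AB d1(2) d2(1) by (meson order_trans)+
  moreover have "replete D (\<T>\<^sub>1 \<star> \<A>)" "replete D (\<B> \<star> \<F>\<^sub>2)"
    using replete_star[OF Ob(1,3)] replete_star[OF Ob(4,2)] .
  ultimately show "s_torsion_pair D \<X> (\<T>\<^sub>1 \<star> \<A>, \<B> \<star> \<F>\<^sub>2)"
    unfolding s_torsion_pair_iff[OF X] by blast
qed

text \<open>The left decomposition is used on the lower part of the interval, from the first pair to
  the given one, and the right decomposition on the upper part.\<close>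

lemma s_torsion_pair_extend_restrict:
  assumes X: "ext_class D \<X>" and p: "s_torsion_pair D \<X> (\<T>\<^sub>1, \<F>\<^sub>1)" "s_torsion_pair D \<X> (\<T>\<^sub>2, \<F>\<^sub>2)"
    and t: "s_torsion_pair D \<X> (\<T>, \<F>)" and le: "\<T>\<^sub>1 \<subseteq> \<T>" "\<T> \<subseteq> \<T>\<^sub>2"
  shows "\<T>\<^sub>1 \<star> (\<T> \<inter> \<F>\<^sub>1) = \<T>" "(\<F> \<inter> \<T>\<^sub>2) \<star> \<F>\<^sub>2 = \<F>"
  using s_torsion_pair_interval_left[OF X p(1) t le(1)] s_torsion_pair_interval_right[OF X t p(2) le(2)]
  by (simp_all add: Int_commute)

lemma s_torsion_pair_restrict_extend:
  assumes X: "ext_class D \<X>" and p: "s_torsion_pair D \<X> (\<T>\<^sub>1, \<F>\<^sub>1)" "s_torsion_pair D \<X> (\<T>\<^sub>2, \<F>\<^sub>2)"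
    and le: "\<T>\<^sub>1 \<subseteq> \<T>\<^sub>2" and t: "s_torsion_pair D (\<T>\<^sub>2 \<inter> \<F>\<^sub>1) (\<A>, \<B>)"
  shows "(\<T>\<^sub>1 \<star> \<A>) \<inter> \<F>\<^sub>1 = \<A>" "(\<B> \<star> \<F>\<^sub>2) \<inter> \<T>\<^sub>2 = \<B>"
proof -
  have K: "ext_class D (\<T>\<^sub>2 \<inter> \<F>\<^sub>1)"
    using ext_class_Int s_torsion_pair_ext_class_left[OF X p(2)] s_torsion_pair_ext_class_right[OF X p(1)]
    by blast
  note x = s_torsion_pair_extend[OF X p le t]
  note r = s_torsion_pair_restrict[OF X p x(1-3)]
  \<comment> \<open>Either half of an \<open>s\<close>-torsion pair determines the other contravariantly, so inclusions in both halves force equality.\<close>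
  have "\<A> \<subseteq> (\<T>\<^sub>1 \<star> \<A>) \<inter> \<F>\<^sub>1" "\<B> \<subseteq> (\<B> \<star> \<F>\<^sub>2) \<inter> \<T>\<^sub>2"
    using x(4,5) s_torsion_pairD(1,2)[OF K t] by auto
  then show "(\<T>\<^sub>1 \<star> \<A>) \<inter> \<F>\<^sub>1 = \<A>" "(\<B> \<star> \<F>\<^sub>2) \<inter> \<T>\<^sub>2 = \<B>"
    using s_torsion_pair_subset_iff[OF K t r] s_torsion_pair_subset_iff[OF K r t] by blast+
qed

end

section \<open>The interval around a t-structure\<close>

context triangulated_category
begin

lemma s_torsion_pair_unshift:
  assumes X: "ext_class D \<X>" and p: "s_torsion_pair D \<X> (\<T>, \<F>)"
  shows "s_torsion_pair D (unshift_class D \<X>) (unshift_class D \<T>, unshift_class D \<F>)"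
proof -
  note d = s_torsion_pairD[OF X p]
  have "hom_vanishes D (unshift_class D (shift_class D \<T>)) (unshift_class D \<F>)"
    using d(6) hom_vanishes_unshift_iff[OF shift_class_subset_Ob[OF d(8)] d(9)] by simp
  then have "hom_vanishes D (shift_class D (unshift_class D \<T>)) (unshift_class D \<F>)"
    by (simp add: shift_unshift_class unshift_shift_class d(8))
  moreover have "unshift_class D \<X> = unshift_class D \<T> \<star> unshift_class D \<F>"
    using unshift_class_star[OF d(8,9)] d(7) by simp
  ultimately show ?thesis
    unfolding s_torsion_pair_iff[OF ext_class_unshift[OF X]]
    using unshift_class_mono[OF d(1)] unshift_class_mono[OF d(2)] replete_unshift_class[OF d(3)]
      replete_unshift_class[OF d(4)] hom_vanishes_unshift_iff[OF d(8,9)] d(5) by simp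
qed

lemma s_torsion_pair_shift:
  assumes X: "ext_class D \<X>" and p: "s_torsion_pair D \<X> (\<T>, \<F>)"
  shows "s_torsion_pair D (shift_class D \<X>) (shift_class D \<T>, shift_class D \<F>)"
proof -
  note d = s_torsion_pairD[OF X p]
  have "hom_vanishes D (shift_class D (shift_class D \<T>)) (shift_class D \<F>)"
    using d(6) hom_vanishes_shift_iff[OF shift_class_subset_Ob[OF d(8)] d(9)] by simp
  moreover have "shift_class D \<X> = shift_class D \<T> \<star> shift_class D \<F>"
    using shift_class_star[OF d(8,9)] d(7) by simp
  ultimately show ?thesis
    unfolding s_torsion_pair_iff[OF ext_class_shift[OF X]]
    using shift_class_mono[OF d(1)] shift_class_mono[OF d(2)] replete_shift_class[OF d(3)]
      replete_shift_class[OF d(4)] hom_vanishes_shift_iff[OF d(8,9)] d(5) by simp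
qed

lemma unshift_pair_iso:
  assumes X: "ext_class D \<X>"
  shows "pairs_iso (stors D \<X>) (stors D (unshift_class D \<X>)) (unshift_pair D)"
proof (rule poset_isoI[where g = "\<lambda>(\<T>, \<F>). (shift_class D \<T>, shift_class D \<F>)"])
  note Y = ext_class_unshift[OF X]
  have Ob: "\<X> \<subseteq> Ob D" using replete_subset[OF ext_class_replete[OF X]] .
  show "inj_on fst (stors D \<X>)" "inj_on fst (stors D (unshift_class D \<X>))"
    using X Y by (simp_all add: inj_on_fst_stors)
  show "unshift_pair D \<in> stors D \<X> \<rightarrow> stors D (unshift_class D \<X>)"
    using s_torsion_pair_unshift[OF X] by (auto simp: stors_def unshift_pair_def)
  show "(\<lambda>(\<T>, \<F>). (shift_class D \<T>, shift_class D \<F>)) \<in> stors D (unshift_class D \<X>) \<rightarrow> stors D \<X>"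
    using s_torsion_pair_shift[OF Y] by (auto simp: stors_def shift_unshift_class[OF Ob])
  fix p p'
  show "(case unshift_pair D p of (\<T>, \<F>) \<Rightarrow> (shift_class D \<T>, shift_class D \<F>)) = p"
    if "p \<in> stors D \<X>"
    using that s_torsion_pairD(8,9)[OF X, of "fst p" "snd p"]
    by (cases p) (simp add: stors_def unshift_pair_def shift_unshift_class)
  show "unshift_pair D (case p of (\<T>, \<F>) \<Rightarrow> (shift_class D \<T>, shift_class D \<F>)) = p"
    if "p \<in> stors D (unshift_class D \<X>)"
    using that s_torsion_pairD(8,9)[OF Y, of "fst p" "snd p"]
    by (cases p) (simp add: stors_def unshift_pair_def unshift_shift_class)
  show "fst (unshift_pair D p) \<subseteq> fst (unshift_pair D p')" if "fst p \<subseteq> fst p'"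
    using that by (cases p, cases p') (simp add: unshift_pair_def unshift_class_mono)
  show "fst (case p of (\<T>, \<F>) \<Rightarrow> (shift_class D \<T>, shift_class D \<F>))
      \<subseteq> fst (case p' of (\<T>, \<F>) \<Rightarrow> (shift_class D \<T>, shift_class D \<F>))" if "fst p \<subseteq> fst p'"
    using that by (cases p, cases p') (simp add: shift_class_mono)
qed

lemma star_zero_objects:
  assumes "replete D \<X>"
  shows "\<X> \<star> Collect (zero_object D) = \<X>"
proof
  show "\<X> \<star> Collect (zero_object D) \<subseteq> \<X>"
  proof
    fix C assume "C \<in> \<X> \<star> Collect (zero_object D)"
    then obtain A Z where AZ: "A \<in> \<X>" "zero_object D Z" "C \<in> Ob D" "dtri D A C Z"
      by (auto elim: starE)
    then have "isomorphic D A C"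
      using dtri_isomorphic_left[OF AZ(4)] null_hom_to_zero[OF AZ(2)] dtri_wf[OF AZ(4)] shift_in_Ob by blast
    then show "C \<in> \<X>" using repleteD[OF assms AZ(1) _ AZ(3)] by blast
  qed
  obtain Z where "zero_object D Z" using zero_object_exists by blast
  then show "\<X> \<subseteq> \<X> \<star> Collect (zero_object D)"
    using subset_star_left[OF replete_subset[OF assms], of Z] by simp
qed

text \<open>The greatest s-torsion pair, needed as the upper end of the interval inside the extended
  heart. The zero class consists of all zero objects so that it is replete.\<close>

lemma s_torsion_pair_top:
  assumes X: "ext_class D \<X>"
  shows "s_torsion_pair D \<X> (\<X>, Collect (zero_object D))"
proof -
  note rep = ext_class_replete[OF X]
  have "replete D (Collect (zero_object D))"
    by (auto simp: iso_closed_in_def zero_object_in_Ob intro: zero_object_isomorphic)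
  moreover have "hom_vanishes D \<A> (Collect (zero_object D))" if "\<A> \<subseteq> Ob D" for \<A>
    using that null_hom_to_zero by (auto simp: hom_vanishes_iff)
  ultimately show ?thesis
    unfolding s_torsion_pair_iff[OF X]
    using rep star_zero_objects[OF rep] ext_class_zero[OF X] shift_class_subset_Ob replete_subset[OF rep]
    by auto
qed

text \<open>Closure of \<open>\<U>\<close> under Sigma restricts Hom(U, Sigma^-1 W) = 0 to Hom(Sigma
  U, Sigma^-1 W) = 0; conversely the latter puts Sigma U into the left orthogonal of Sigma^-1 W,
  which is U. The bound on \<open>\<W>\<close> is stated apart because \<open>unshift_class\<close>
  is meaningful only inside \<open>Ob D\<close>.\<close>

lemma t_structure_iff:
  "t_structure D (\<U>, \<W>) \<longleftrightarrow> \<W> \<subseteq> Ob D \<and> s_torsion_pair D (Ob D) (\<U>, unshift_class D \<W>)"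
proof
  assume "t_structure D (\<U>, \<W>)"
  then have t: "replete D \<U>" "replete D \<W>" "shift_class D \<U> \<subseteq> \<U>"
      "hom_vanishes D \<U> (unshift_class D \<W>)" "Ob D = \<U> \<star> unshift_class D \<W>"
    unfolding t_structure_def by blast+
  show "\<W> \<subseteq> Ob D \<and> s_torsion_pair D (Ob D) (\<U>, unshift_class D \<W>)"
    unfolding s_torsion_pair_iff[OF ext_class_Ob]
    using t(1,4,5) replete_subset[OF t(1)] replete_subset[OF t(2)] replete_unshift_class[OF t(2)]
      unshift_class_subset_Ob[OF replete_subset[OF t(2)]] hom_vanishes_mono[OF t(4) t(3) subset_refl]
    by blast
next
  assume a: "\<W> \<subseteq> Ob D \<and> s_torsion_pair D (Ob D) (\<U>, unshift_class D \<W>)"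
  then have W: "\<W> \<subseteq> Ob D" and p: "s_torsion_pair D (Ob D) (\<U>, unshift_class D \<W>)" by auto
  note d = s_torsion_pairD[OF ext_class_Ob p]
  have "replete D \<W>"
    using replete_shift_class[OF d(4)] by (simp add: shift_unshift_class W)
  moreover have "shift_class D \<U> \<subseteq> \<U>"
    using s_torsion_pair_left_iff[OF ext_class_Ob p] shift_class_subset_Ob[OF d(8)] hom_vanishesD[OF d(6)]
    by blast
  ultimately show "t_structure D (\<U>, \<W>)"
    using d(3,5,7) by (simp add: t_structure_def)
qed

end

section \<open>The interval from Sigma U to Sigma^-1 U and the extended tilt\<close>

locale t_structure_category = triangulated_category D
  for D :: "('o, 'm, 'z) pretriangulated_scheme" (structure) +
  fixes \<U> \<W> :: "'o set"
  assumes t_str: "t_structure D (\<U>, \<W>)"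
begin

abbreviation "\<Sigma>\<^sub>U \<equiv> shift_class D \<U>"
abbreviation "\<Omega>\<^sub>U \<equiv> unshift_class D \<U>"
abbreviation "\<Omega>\<^sub>W \<equiv> unshift_class D \<W>"
abbreviation "\<H> \<equiv> heart D (\<U>, \<W>)"
abbreviation "\<C> \<equiv> extended_heart D (\<U>, \<W>)"
abbreviation "\<Omega>\<^sub>H \<equiv> unshift_class D \<H>"

lemma coaisle_subset_Ob: "\<W> \<subseteq> Ob D"
  using t_str t_structure_iff by blast

lemma s_torsion_pair_aisle: "s_torsion_pair D (Ob D) (\<U>, \<Omega>\<^sub>W)"
  using t_str t_structure_iff by blast

text \<open>The lower end of the interval: shifting the pair once turns the torsion-free class
  Sigma^-1 W into W itself.\<close>

lemma s_torsion_pair_shift_aisle: "s_torsion_pair D (Ob D) (\<Sigma>\<^sub>U, \<W>)"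
  using s_torsion_pair_shift[OF ext_class_Ob s_torsion_pair_aisle]
  by (simp add: shift_class_Ob shift_unshift_class coaisle_subset_Ob)

lemma s_torsion_pair_unshift_aisle: "s_torsion_pair D (Ob D) (\<Omega>\<^sub>U, unshift_class D \<Omega>\<^sub>W)"
  using s_torsion_pair_unshift[OF ext_class_Ob s_torsion_pair_aisle] by (simp add: unshift_class_Ob)

lemmas aisle_subset_Ob = s_torsion_pairD(8)[OF ext_class_Ob s_torsion_pair_aisle]

lemma shift_aisle_subset: "\<Sigma>\<^sub>U \<subseteq> \<U>"
  using t_str by (simp add: t_structure_def)

lemma aisle_subset_unshift: "\<U> \<subseteq> \<Omega>\<^sub>U"
  using unshift_class_mono[OF shift_aisle_subset] unshift_shift_class[OF aisle_subset_Ob] by simp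

lemma shift_aisle_subset_unshift: "\<Sigma>\<^sub>U \<subseteq> \<Omega>\<^sub>U"
  using shift_aisle_subset aisle_subset_unshift by (rule order_trans)

text \<open>This is \<open>\<T>\<^sub>2 \<inter> \<F>\<^sub>1\<close> for the interval with ends
  Sigma U and Sigma^-1 U.\<close>

lemma extended_heart_eq: "\<C> = \<Omega>\<^sub>U \<inter> \<W>"
  by (auto simp: extended_heart_def)

lemma unshift_heart_eq: "\<Omega>\<^sub>H = \<Omega>\<^sub>W \<inter> \<Omega>\<^sub>U"
  using unshift_class_Int[OF aisle_subset_Ob coaisle_subset_Ob] by (auto simp: heart_def)

lemma ext_class_heart: "ext_class D \<H>"
  unfolding heart_def
  using ext_class_Int[OF s_torsion_pair_ext_class_left[OF ext_class_Ob s_torsion_pair_aisle]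
      s_torsion_pair_ext_class_right[OF ext_class_Ob s_torsion_pair_shift_aisle]] by simp

lemma ext_class_extended_heart: "ext_class D \<C>"
  unfolding extended_heart_eq
  by (rule ext_class_Int[OF s_torsion_pair_ext_class_left[OF ext_class_Ob s_torsion_pair_unshift_aisle]
      s_torsion_pair_ext_class_right[OF ext_class_Ob s_torsion_pair_shift_aisle]])

text \<open>The given t-structure is itself a point of the interval. Its restriction has halves U
  cap W, which is H, and Sigma^-1 W cap Sigma^-1 U, which is Sigma^-1 H.\<close>

lemma s_torsion_pair_heart: "s_torsion_pair D \<C> (\<H>, \<Omega>\<^sub>H)"
  using s_torsion_pair_restrict[OF ext_class_Ob s_torsion_pair_shift_aisle s_torsion_pair_unshift_aisle
      s_torsion_pair_aisle shift_aisle_subset aisle_subset_unshift]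
  unfolding extended_heart_eq unshift_heart_eq by (simp add: heart_def)

text \<open>The left decomposition for Sigma U inside U, where the torsion-free class of the smaller
  pair is W.\<close>

lemma shift_aisle_star_heart: "\<Sigma>\<^sub>U \<star> \<H> = \<U>"
  using s_torsion_pair_interval_left[OF ext_class_Ob s_torsion_pair_shift_aisle s_torsion_pair_aisle
      shift_aisle_subset] by (simp only: heart_def prod.case)

lemma mem_stors_minus_iff:
  "(\<X>, \<Y>) \<in> stors_minus D (\<U>, \<W>) \<longleftrightarrow> s_torsion_pair D \<C> (\<X>, \<Y>) \<and> \<H> \<subseteq> \<X>"
  by (simp add: stors_minus_def stors_def)

lemma mem_tstr_near_minus_iff:
  "(\<U>', \<W>') \<in> tstr_near_minus D (\<U>, \<W>) \<longleftrightarrow>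
    \<W>' \<subseteq> Ob D \<and> s_torsion_pair D (Ob D) (\<U>', unshift_class D \<W>') \<and> \<U> \<subseteq> \<U>' \<and> \<U>' \<subseteq> \<Omega>\<^sub>U"
  using shift_aisle_subset by (auto simp: tstr_near_minus_def tstr_near_def t_structure_iff)

lemma inj_on_fst_stors_minus: "inj_on fst (stors_minus D (\<U>, \<W>))"
  by (rule inj_on_subset[OF inj_on_fst_stors[OF ext_class_extended_heart]]) (auto simp: stors_minus_def)

text \<open>The aisle determines Sigma^-1 W' as its right orthogonal, and shifting back recovers
  W'.\<close>

lemma inj_on_fst_tstr_near_minus: "inj_on fst (tstr_near_minus D (\<U>, \<W>))"
proof (rule inj_onI)
  fix p q assume pq: "p \<in> tstr_near_minus D (\<U>, \<W>)" "q \<in> tstr_near_minus D (\<U>, \<W>)" "fst p = fst q"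
  obtain \<T> \<A> \<B> where e: "p = (\<T>, \<A>)" "q = (\<T>, \<B>)"
    using pq(3) by (metis prod.collapse)
  have "(\<T>, unshift_class D \<A>) \<in> stors D (Ob D)" "(\<T>, unshift_class D \<B>) \<in> stors D (Ob D)"
    using pq(1,2) by (simp_all add: e mem_tstr_near_minus_iff stors_def)
  then have "unshift_class D \<A> = unshift_class D \<B>"
    using inj_onD[OF inj_on_fst_stors[OF ext_class_Ob]] by force
  then have "shift_class D (unshift_class D \<A>) = shift_class D (unshift_class D \<B>)" by simp
  then show "p = q"
    using pq(1,2) by (simp add: e mem_tstr_near_minus_iff shift_unshift_class)
qed

lemma extended_tilt_eq: "extended_tilt D (\<U>, \<W>) (\<X>, \<Y>) = (\<Sigma>\<^sub>U \<star> \<X>, shift_class D \<Y> \<star> \<Omega>\<^sub>W)"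
  by (simp add: extended_tilt_def)

lemma shift_class_star_unshift:
  "\<Y> \<subseteq> Ob D \<Longrightarrow> shift_class D (\<Y> \<star> unshift_class D \<Omega>\<^sub>W) = shift_class D \<Y> \<star> \<Omega>\<^sub>W"
  using shift_class_star[of \<Y> "unshift_class D \<Omega>\<^sub>W"]
  by (simp add: unshift_class_subset_Ob shift_unshift_class coaisle_subset_Ob)

text \<open>Extension and restriction along the interval are the two directions. A t-structure
  records W' while its s-torsion pair contains Sigma^-1 W', so second components differ by one
  shift.\<close>

lemma extended_tilt_iso:
  "pairs_iso (stors_minus D (\<U>, \<W>)) (tstr_near_minus D (\<U>, \<W>)) (extended_tilt D (\<U>, \<W>))"
proof (rule poset_isoI[OF inj_on_fst_stors_minus inj_on_fst_tstr_near_minus])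
  \<comment> \<open>The restriction map, with \<open>\<W>\<close> as \<open>\<F>\<^sub>1\<close>,
    \<open>\<Omega>\<^sub>U\<close> as \<open>\<T>\<^sub>2\<close> and Sigma^-1 W' as the
    torsion-free class.\<close>
  let ?g = "\<lambda>(\<U>', \<W>'). (\<U>' \<inter> \<W>, unshift_class D \<W>' \<inter> \<Omega>\<^sub>U)"
  note X = ext_class_Ob and p = s_torsion_pair_shift_aisle s_torsion_pair_unshift_aisle
  note le = shift_aisle_subset_unshift
  have unshift: "unshift_class D (shift_class D \<Y> \<star> \<Omega>\<^sub>W) = \<Y> \<star> unshift_class D \<Omega>\<^sub>W"
    if "s_torsion_pair D \<C> (\<X>, \<Y>)" for \<X> \<Y>
    using shift_class_star_unshift[OF s_torsion_pairD(9)[OF ext_class_extended_heart that]]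
      unshift_shift_class[OF star_subset_Ob[of \<Y> "unshift_class D \<Omega>\<^sub>W"]] by simp
  show "extended_tilt D (\<U>, \<W>) \<in> stors_minus D (\<U>, \<W>) \<rightarrow> tstr_near_minus D (\<U>, \<W>)"
  proof
    fix q assume q: "q \<in> stors_minus D (\<U>, \<W>)"
    obtain \<X> \<Y> where e: "q = (\<X>, \<Y>)" by force
    have t: "s_torsion_pair D \<C> (\<X>, \<Y>)" "\<H> \<subseteq> \<X>" using q by (simp_all add: e mem_stors_minus_iff)
    note x = s_torsion_pair_extend[OF X p le t(1)[unfolded extended_heart_eq]]
    \<comment> \<open>Starring the inclusion of H in X with Sigma U on the left gives the lower
      bound U, since Sigma U star H is U.\<close>
    have "\<U> \<subseteq> \<Sigma>\<^sub>U \<star> \<X>"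
      using star_mono[OF subset_refl[of \<Sigma>\<^sub>U] t(2), of D] by (simp only: shift_aisle_star_heart)
    then show "extended_tilt D (\<U>, \<W>) q \<in> tstr_near_minus D (\<U>, \<W>)"
      using x(1,3) star_subset_Ob by (simp add: e extended_tilt_eq mem_tstr_near_minus_iff unshift[OF t(1)])
  qed
  have restr: "s_torsion_pair D \<C> (\<U>' \<inter> \<W>, unshift_class D \<W>' \<inter> \<Omega>\<^sub>U)" "\<Sigma>\<^sub>U \<subseteq> \<U>'"
    if "(\<U>', \<W>') \<in> tstr_near_minus D (\<U>, \<W>)" for \<U>' \<W>'
  proof -
    show "\<Sigma>\<^sub>U \<subseteq> \<U>'" using that shift_aisle_subset by (auto simp: mem_tstr_near_minus_iff)
    then show "s_torsion_pair D \<C> (\<U>' \<inter> \<W>, unshift_class D \<W>' \<inter> \<Omega>\<^sub>U)"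
      unfolding extended_heart_eq
      using s_torsion_pair_restrict[OF X p] that by (simp add: mem_tstr_near_minus_iff)
  qed
  show "?g \<in> tstr_near_minus D (\<U>, \<W>) \<rightarrow> stors_minus D (\<U>, \<W>)"
  proof
    fix q assume q: "q \<in> tstr_near_minus D (\<U>, \<W>)"
    obtain \<U>' \<W>' where e: "q = (\<U>', \<W>')" by force
    have "\<H> \<subseteq> \<U>' \<inter> \<W>" using q by (auto simp: e mem_tstr_near_minus_iff heart_def)
    then show "?g q \<in> stors_minus D (\<U>, \<W>)"
      using restr(1) q by (simp add: e mem_stors_minus_iff)
  qed
  show "?g (extended_tilt D (\<U>, \<W>) q) = q" if q: "q \<in> stors_minus D (\<U>, \<W>)" for q
  proof -
    obtain \<X> \<Y> where e: "q = (\<X>, \<Y>)" by force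
    have t: "s_torsion_pair D \<C> (\<X>, \<Y>)" using q by (simp add: e mem_stors_minus_iff)
    show ?thesis
      using s_torsion_pair_restrict_extend[OF X p le t[unfolded extended_heart_eq]]
      by (simp add: e extended_tilt_eq unshift[OF t])
  qed
  show "extended_tilt D (\<U>, \<W>) (?g q) = q" if q: "q \<in> tstr_near_minus D (\<U>, \<W>)" for q
  proof -
    obtain \<U>' \<W>' where e: "q = (\<U>', \<W>')" by force
    have t: "\<W>' \<subseteq> Ob D" "s_torsion_pair D (Ob D) (\<U>', unshift_class D \<W>')" "\<U>' \<subseteq> \<Omega>\<^sub>U"
      using q by (simp_all add: e mem_tstr_near_minus_iff)
    note r = restr[OF q[unfolded e]]
    show ?thesis
      using s_torsion_pair_extend_restrict[OF X p t(2) r(2) t(3)]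
        shift_class_star_unshift[OF s_torsion_pairD(9)[OF ext_class_extended_heart r(1)]]
      by (simp add: e extended_tilt_eq shift_unshift_class[OF t(1)])
  qed
  show "fst (extended_tilt D (\<U>, \<W>) q) \<subseteq> fst (extended_tilt D (\<U>, \<W>) q')" if "fst q \<subseteq> fst q'" for q q'
    using that star_mono[of \<Sigma>\<^sub>U \<Sigma>\<^sub>U "fst q" "fst q'" D] by (cases q, cases q') (simp add: extended_tilt_def)
  show "fst (?g q) \<subseteq> fst (?g q')" if "fst q \<subseteq> fst q'" for q q'
    using that by (auto split: prod.split)
qed

section \<open>The interval above the heart inside the extended heart\<close>

lemma unshift_heart_subset: "\<Omega>\<^sub>H \<subseteq> \<C>"
  by (rule s_torsion_pairD(2)[OF ext_class_extended_heart s_torsion_pair_heart])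

lemma heart_subset: "\<H> \<subseteq> \<C>"
  by (rule s_torsion_pairD(1)[OF ext_class_extended_heart s_torsion_pair_heart])

lemma extended_heart_Int_unshift_heart: "\<C> \<inter> \<Omega>\<^sub>H = \<Omega>\<^sub>H"
  using unshift_heart_subset by auto

text \<open>Extension along the interval from \<open>(\<H>, \<Omega>\<^sub>H)\<close> to the
  greatest pair of \<open>\<C>\<close>. The class of this interval is
  \<open>\<Omega>\<^sub>H\<close>, and \<open>\<F>\<close> is unchanged because starring with zero
  objects has no effect.\<close>

lemma stors_unshift_heart_extend:
  assumes "s_torsion_pair D \<Omega>\<^sub>H (\<T>, \<F>)"
  shows "s_torsion_pair D \<C> (\<H> \<star> \<T>, \<F>)" "\<H> \<subseteq> \<H> \<star> \<T>" "(\<H> \<star> \<T>) \<inter> \<Omega>\<^sub>H = \<T>"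
proof -
  note X = ext_class_extended_heart
  note p = s_torsion_pair_heart s_torsion_pair_top[OF X]
  have t: "s_torsion_pair D (\<C> \<inter> \<Omega>\<^sub>H) (\<T>, \<F>)"
    using assms by (simp add: extended_heart_Int_unshift_heart)
  have "replete D \<F>"
    by (rule s_torsion_pairD(4)[OF ext_class_unshift[OF ext_class_heart] assms])
  then show "s_torsion_pair D \<C> (\<H> \<star> \<T>, \<F>)"
    using s_torsion_pair_extend(1)[OF X p heart_subset t] by (simp add: star_zero_objects)
  show "\<H> \<subseteq> \<H> \<star> \<T>"
    by (rule s_torsion_pair_extend(2)[OF X p heart_subset t])
  show "(\<H> \<star> \<T>) \<inter> \<Omega>\<^sub>H = \<T>"
    by (rule s_torsion_pair_restrict_extend(1)[OF X p heart_subset t])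
qed

text \<open>Restriction along the same interval; intersecting with \<open>\<C>\<close> leaves the
  second component as it is.\<close>

lemma stors_minus_restrict:
  assumes "s_torsion_pair D \<C> (\<X>, \<Y>)" "\<H> \<subseteq> \<X>"
  shows "s_torsion_pair D \<Omega>\<^sub>H (\<X> \<inter> \<Omega>\<^sub>H, \<Y>)" "\<H> \<star> (\<X> \<inter> \<Omega>\<^sub>H) = \<X>"
proof -
  note X = ext_class_extended_heart
  note p = s_torsion_pair_heart s_torsion_pair_top[OF X]
  note d = s_torsion_pairD(1,2)[OF X assms(1)]
  have "\<Y> \<inter> \<C> = \<Y>" using d(2) by auto
  then show "s_torsion_pair D \<Omega>\<^sub>H (\<X> \<inter> \<Omega>\<^sub>H, \<Y>)"
    using s_torsion_pair_restrict[OF X p assms d(1)] by (simp add: extended_heart_Int_unshift_heart)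
  show "\<H> \<star> (\<X> \<inter> \<Omega>\<^sub>H) = \<X>"
    by (rule s_torsion_pair_extend_restrict(1)[OF X p assms d(1)])
qed

lemma lambda_minus_Pi: "lambda_minus D (\<U>, \<W>) \<in> stors_minus D (\<U>, \<W>) \<rightarrow> stors D \<Omega>\<^sub>H"
  using stors_minus_restrict(1) by (auto simp: lambda_minus_def mem_stors_minus_iff stors_def)

lemma mu_minus_Pi: "mu_minus D (\<U>, \<W>) \<in> stors D \<Omega>\<^sub>H \<rightarrow> stors_minus D (\<U>, \<W>)"
  using stors_unshift_heart_extend(1,2) by (auto simp: mu_minus_def mem_stors_minus_iff stors_def)

lemma lambda_mu: "p \<in> stors D \<Omega>\<^sub>H \<Longrightarrow> lambda_minus D (\<U>, \<W>) (mu_minus D (\<U>, \<W>) p) = p"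
  using stors_unshift_heart_extend(3)
  by (auto simp: lambda_minus_def mu_minus_def stors_def split: prod.splits)

lemma mu_lambda: "p \<in> stors_minus D (\<U>, \<W>) \<Longrightarrow> mu_minus D (\<U>, \<W>) (lambda_minus D (\<U>, \<W>) p) = p"
  using stors_minus_restrict(2)
  by (auto simp: lambda_minus_def mu_minus_def mem_stors_minus_iff split: prod.splits)

lemma mu_minus_iso: "pairs_iso (stors D \<Omega>\<^sub>H) (stors_minus D (\<U>, \<W>)) (mu_minus D (\<U>, \<W>))"
proof (rule poset_isoI[OF _ inj_on_fst_stors_minus mu_minus_Pi lambda_minus_Pi lambda_mu mu_lambda])
  show "inj_on fst (stors D \<Omega>\<^sub>H)"
    by (rule inj_on_fst_stors[OF ext_class_unshift[OF ext_class_heart]])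
  show "fst (mu_minus D (\<U>, \<W>) q) \<subseteq> fst (mu_minus D (\<U>, \<W>) q')" if "fst q \<subseteq> fst q'" for q q'
    using that star_mono[of \<H> \<H> "fst q" "fst q'" D] by (cases q, cases q') (simp add: mu_minus_def)
  show "fst (lambda_minus D (\<U>, \<W>) q) \<subseteq> fst (lambda_minus D (\<U>, \<W>) q')" if "fst q \<subseteq> fst q'" for q q'
    using that by (auto simp: lambda_minus_def split: prod.split)
qed

text \<open>Order reversal between the halves, applied to \<open>(\<H>, \<Omega>\<^sub>H)\<close>
  and the given pair.\<close>

lemma stors_minus_eq: "stors_minus D (\<U>, \<W>) = {(\<X>, \<Y>) \<in> stors D \<C>. \<Y> \<subseteq> \<Omega>\<^sub>H}"
proof -
  have "\<H> \<subseteq> \<X> \<longleftrightarrow> \<Y> \<subseteq> \<Omega>\<^sub>H" if "s_torsion_pair D \<C> (\<X>, \<Y>)" for \<X> \<Y>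
    by (rule s_torsion_pair_subset_iff[OF ext_class_extended_heart s_torsion_pair_heart that])
  then show ?thesis by (auto simp: stors_minus_def stors_def)
qed

text \<open>Associativity lets Sigma U absorb H in the first component; in the second, Sigma cancels
  Sigma^-1 on F.\<close>

lemma left_HRS_tilt_eq:
  assumes "p \<in> stors D \<H>"
  shows "extended_tilt D (\<U>, \<W>) (mu_minus D (\<U>, \<W>) (unshift_pair D p)) = left_HRS_tilt D (\<U>, \<W>) p"
proof -
  obtain \<T> \<F> where e: "p = (\<T>, \<F>)" by force
  have F: "\<F> \<subseteq> Ob D"
    using s_torsion_pairD(9)[OF ext_class_heart] assms by (simp add: e stors_def)
  have "\<Sigma>\<^sub>U \<star> (\<H> \<star> unshift_class D \<T>) = \<U> \<star> unshift_class D \<T>"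
    using star_assoc[OF shift_class_subset_Ob[OF aisle_subset_Ob]
        replete_subset[OF ext_class_replete[OF ext_class_heart]]]
    by (simp only: shift_aisle_star_heart)
  then show ?thesis
    by (simp add: e extended_tilt_def mu_minus_def unshift_pair_def left_HRS_tilt_def shift_unshift_class[OF F])
qed

text \<open>The tilt inherits the property as a composite of the three isomorphisms already
  established.\<close>

lemma left_HRS_tilt_iso:
  "pairs_iso (stors D \<H>) (tstr_near_minus D (\<U>, \<W>)) (left_HRS_tilt D (\<U>, \<W>))"
  by (rule poset_iso_comp[OF poset_iso_comp[OF unshift_pair_iso[OF ext_class_heart] mu_minus_iso refl]
      extended_tilt_iso left_HRS_tilt_eq[symmetric]])

end

theorem theorem4p10:
  fixes D :: "('o, 'm, 'z) pretriangulated_scheme"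
    and u :: "'o set \<times> 'o set"
    and \<H> \<C> :: "'o set"
  assumes "triangulated_category D"
    and "t_structure D u"
    and "\<H> = heart D u"
    and "\<C> = extended_heart D u"
  shows
    "(pairs_iso (stors D (unshift_class D \<H>)) (stors_minus D u) (mu_minus D u) \<and>
      lambda_minus D u \<in> stors_minus D u \<rightarrow> stors D (unshift_class D \<H>) \<and>
      (\<forall>p \<in> stors D (unshift_class D \<H>). lambda_minus D u (mu_minus D u p) = p) \<and>
      (\<forall>p \<in> stors_minus D u. mu_minus D u (lambda_minus D u p) = p) \<and>
      (\<forall>(\<X>, \<Y>) \<in> stors_minus D u. \<X> = \<H> \<star>\<^bsub>D\<^esub> (\<X> \<inter> unshift_class D \<H>)) \<and>
      (\<forall>(\<T>, \<F>) \<in> stors D (unshift_class D \<H>). \<T> = (\<H> \<star>\<^bsub>D\<^esub> \<T>) \<inter> unshift_class D \<H>) \<and>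
      stors_minus D u = {(\<X>, \<Y>) \<in> stors D \<C>. \<Y> \<subseteq> unshift_class D \<H>}) \<and>
     ((\<forall>p \<in> stors D \<H>.
        extended_tilt D u (mu_minus D u (unshift_pair D p)) = left_HRS_tilt D u p) \<and>
      pairs_iso (stors_minus D u) (tstr_near_minus D u) (extended_tilt D u) \<and>
      pairs_iso (stors D (unshift_class D \<H>)) (stors_minus D u) (mu_minus D u) \<and>
      pairs_iso (stors D \<H>) (stors D (unshift_class D \<H>)) (unshift_pair D) \<and>
      pairs_iso (stors D \<H>) (tstr_near_minus D u) (left_HRS_tilt D u))"
proof -
  obtain \<U> \<W> where u: "u = (\<U>, \<W>)" by force
  interpret t_structure_category D \<U> \<W>
    using assms(1,2) by (simp add: t_structure_category_def t_structure_category_axioms_def u)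
  show ?thesis
    unfolding assms(3,4) u
  proof (intro conjI ballI)
    show "case p of (\<X>, \<Y>) \<Rightarrow> \<X> = heart D (\<U>, \<W>) \<star>\<^bsub>D\<^esub> (\<X> \<inter> unshift_class D (heart D (\<U>, \<W>)))"
      if "p \<in> stors_minus D (\<U>, \<W>)" for p
      using that stors_minus_restrict(2) by (auto simp: mem_stors_minus_iff)
    show "case p of (\<T>, \<F>) \<Rightarrow> \<T> = (heart D (\<U>, \<W>) \<star>\<^bsub>D\<^esub> \<T>) \<inter> unshift_class D (heart D (\<U>, \<W>))"
      if "p \<in> stors D (unshift_class D (heart D (\<U>, \<W>)))" for p
      using that stors_unshift_heart_extend(3) by (auto simp: stors_def)
  qed (fact mu_minus_iso lambda_minus_Pi stors_minus_eq extended_tilt_iso left_HRS_tilt_iso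
      unshift_pair_iso[OF ext_class_heart] | erule lambda_mu mu_lambda left_HRS_tilt_eq)+
qed

end
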